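(* The psi-calculus $\mathbf{SORTEDPPI}$ is a complete representation of the sorted polyadic pi-calculus.
   Context: **Names, nominal sets.** $\mathrm S$ is a countable set of subject sorts; for each $s\in\mathrm S$ there is a countably infinite set $\mathcal N_s$ of names of sort $s$, pairwise disjoint; $\mathcal N=\bigcup_s\mathcal N_s$. $\mathtt{ob}:\mathrm S\rightharpoonup\mathrm S^*$ is a partial function. A tilde denotes a finite tuple (or the set of its entries). $\mathrm n(T)$ is the (finite) support of $T$, i.e. its free names; $a\#T$ means $a\notin\mathrm n(T)$. Swappings, alpha-conversion and substitution preserve sorts of names. Equivariant means preserved by all such swappings. **The sorted psi-calculus SORTEDPPI.** Sorts: $\mathcal S=\mathrm S\cup\{\langle\tilde s\rangle:\tilde s\in\mathrm S^*\}$. Terms: $\mathbf T=\mathcal N\cup\{\langle\tilde a\rangle:\tilde a\in\mathcal N^*\}$, with $\mathrm{SORT}(\langle a_1,\dots,a_n\rangle)=\langle\mathrm{SORT}(a_1),\dots,\mathrm{SORT}(a_n)\rangle$. Conditions: $\mathbf C=\{\top,\bot\}\cup\{a=b:a,b\in\mathcal N\}$. Assertions: $\mathbf A=\{\mathbf 1\}$, $\mathbf 1\otimes\mathbf 1=\mathbf 1$. Entailment: $\mathbf 1\vdash\top$; $\mathbf 1\vdash a=b$ iff $a$ and $b$ are the same name; $\mathbf 1\not\vdash\bot$. Channel equivalence: $a\leftrightarrow b$ is the condition $a=b$ for names, and $M\leftrightarrow N$ is $\bot$ if $M,N$ are not both names. Patterns: $\mathbf X=\{\langle\tilde a\rangle:\tilde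 a\in\mathcal N^*\text{ with distinct entries}\}$, sorted as tuples; $\mathrm{vars}(\langle\tilde a\rangle)=\{\tilde a\}$. $\mathrm{Match}(\langle\tilde a\rangle,\tilde x,\langle\tilde y\rangle)=\{\pi\cdot\tilde a\}$ if $\tilde x=\pi\cdot\tilde y$ for a permutation $\pi$ of tuple positions and $\mathrm{SORT}(\langle\tilde a\rangle)=\mathrm{SORT}(\langle\tilde y\rangle)$; $\mathrm{Match}$ is $\emptyset$ otherwise. Only names can be substituted for names, and only of the same sort; substitution is the usual simultaneous one (patterns are unaffected, all their names being bound). All names may be restricted. A term of sort $s$ can send terms of, and receive with patterns of, sort $t$ iff $s\in\mathrm{dom}(\mathtt{ob})$ and $t=\langle\mathtt{ob}(s)\rangle$. **Agents.** $\overline M\,N.P$ (well-formed only if $M$ is a name of some sort $s$ and $\mathrm{SORT}(N)=\langle\mathtt{ob}(s)\rangle$); $\underline M(\lambda\tilde x)X.P$ (well-formed only if $M$ is a name of some sort $s$, $\mathrm{SORT}(X)=\langle\mathtt{ob}(s)\rangle$ and $\tilde x$ is a tuple of distinct names listing exactly the names of $X$; $\tilde x$ binds in $X$ and $P$); $\mathbf{case}\ \varphi_1:P_1[]\cdots[]\varphi_n:P_n$ (the empty case is $\mathbf 0$); $(\nu a)P$; $P\mid Q$; $!P$; $(\!|\Psi|\!)$. Agents are identified up to alpha-equivalence. An assertion is unguarded if not inside an input or output; well-formed agents must have no unguarded assertions inside the body of a replication or inside a branch of a case. Only well-formed agents are considered. Substitution on agents is capture-avoiding. **Transitions of SORTEDPPI**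 (the only assertion being $\mathbf 1$, it is omitted). Actions: $\overline M(\nu\tilde a)N$ with $\tilde a\subseteq\mathrm n(N)$ (bound names $\tilde a$; written $\overline M\,N$ if $\tilde a$ is empty), $\underline M\,N$, $\tau$. Bound names bind into object and derivative. - In: $\underline M(\lambda\tilde y)X.P\xrightarrow{\underline K\,N}P[\tilde y:=\tilde L]$ if $\mathbf 1\vdash M\leftrightarrow K$ and $\tilde L\in\mathrm{Match}(N,\tilde y,X)$. - Out: $\overline M\,N.P\xrightarrow{\overline K\,N}P$ if $\mathbf 1\vdash M\leftrightarrow K$. - Com: if $P\xrightarrow{\overline M(\nu\tilde a)N}P'$, $Q\xrightarrow{\underline K\,N}Q'$, $\mathbf 1\vdash M\leftrightarrow K$, $\tilde a\#Q$, then $P\mid Q\xrightarrow\tau(\nu\tilde a)(P'\mid Q')$ (and symmetrically). - Par: if $P\xrightarrow\alpha P'$ and $\mathrm{bn}(\alpha)\#Q$ then $P\mid Q\xrightarrow\alpha P'\mid Q$ (and symmetrically). - Case: if $P_i\xrightarrow\alpha P'$ and $\mathbf 1\vdash\varphi_i$ then $\mathbf{case}\ \tilde\varphi:\tilde P\xrightarrow\alpha P'$. - Rep: if $P\mid{!P}\xrightarrow\alpha P'$ then $!P\xrightarrow\alpha P'$. - Scope: if $P\xrightarrow\alpha P'$ and $b\#\alpha$ then $(\nu b)P\xrightarrow\alpha(\nu b)P'$. - Open: if $P\xrightarrow{\overline M(\nu\tilde a)N}P'$, $b\#\tilde a,M$, $b\in\mathrm n(N)$, then $(\nu b)P\xrightarrow{\overline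 M(\nu\tilde a\cup\{b\})N}P'$, where $\tilde a\cup\{b\}$ is $\tilde a$ with $b$ inserted anywhere. **Strong bisimulation congruence.** Since $\mathbf A=\{\mathbf 1\}$, a strong bisimulation is a symmetric relation $\mathcal R$ on agents whose related agents have frames entailing the same conditions (automatic here) and such that if $P\,\mathcal R\,Q$, $\mathrm{bn}(\alpha)\#Q$ and $P\xrightarrow\alpha P'$ then $Q\xrightarrow\alpha Q'$ with $P'\,\mathcal R\,Q'$ for some $Q'$; $\dot\sim$ is the largest one. $P\sim Q$ iff $P\tilde\sigma\mathrel{\dot\sim}Q\tilde\sigma$ for all finite sequences $\tilde\sigma$ of (sort-preserving) substitutions. **Structural congruence of psi-agents.** $\equiv$ is the smallest equivalence relation on agents closed under all agent constructors satisfying, whenever $a\#Q,\tilde x,M,N,X,\tilde\varphi$: $\mathbf{case}\ \varphi_1:(\nu a)P_1[]\cdots[]\varphi_n:(\nu a)P_n\equiv(\nu a)\mathbf{case}\ \tilde\varphi:\tilde P$; $\underline M(\lambda\tilde x)X.(\nu a)P\equiv(\nu a)\underline M(\lambda\tilde x)X.P$; $\overline M\,N.(\nu a)P\equiv(\nu a)\overline M\,N.P$; $Q\mid(\nu a)P\equiv(\nu a)(Q\mid P)$; $(\nu b)(\nu a)P\equiv(\nu a)(\nu b)P$; $!P\equiv P\mid{!P}$; $P\mid(Q\mid R)\equiv(P\mid Q)\mid R$; $P\mid Q\equiv Q\mid P$; $P\equiv P\mid\mathbf 0$; $(\nu a)\mathbf 0\equiv\mathbf 0$. **Representation.** A context $C$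 of arity $k$ is a (raw) psi-calculus process term with $k$ occurrences of $\mathbf 0$ replaced by holes, and $C[P_1,\dots,P_k]$ fills the holes from left to right (possibly capturing names). A psi-calculus is a representation of a process calculus with processes $\mathcal P$ and labelled transition system $\to\;\subseteq\mathcal P\times\mathcal A\times\mathcal P$ if there exist an equivariant map $[\![\cdot]\!]$ from $\mathcal P$ to psi-calculus processes and an equivariant relation $\approxeq$ between $\mathcal A$ and psi-calculus actions such that: (1) for each process constructor $f$ of $\mathcal P$ there is an equivariant psi-calculus context $C$ (depending equivariantly on the name parameters of $f$, such as $x,\tilde y$ in $x(\tilde y).[\,]$) such that $[\![f(P_1,\dots,P_n)]\!]=C[[\![P_1]\!],\dots,[\![P_n]\!]]$; (2a) whenever $P\xrightarrow\beta P'$ there are $\alpha,Q$ with $[\![P]\!]\xrightarrow\alpha Q$, $[\![P']\!]\equiv Q$ and $\beta\approxeq\alpha$; (2b) whenever $[\![P]\!]\xrightarrow\alpha Q$ there are $\beta,P'$ with $P\xrightarrow\beta P'$, $[\![P']\!]\equiv Q$ and $\beta\approxeq\alpha$. It is complete if moreover (3) for each psi process $P$ there is $Q\in\mathcal P$ with $P\sim[\![Q]\!]$. **Sorted polyadic pi-calculus.** Its processes are the well-sorted processes among $P,Q::=\mathbf 0\mid x(\tilde y).P\mid\overline x\langle\tilde y\rangle.P\mid[a=b]P\mid\nu x\,P\mid{!P}\mid P\mid Q\mid P+Q$, where in $x(\tilde y).P$ the names $\tilde y$ are distinct and bind in $P$, $\nu x$ binds $x$, processes are up to alpha-equivalence,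 and $\mathrm{fn}$ denotes free names. A process is well-sorted if for every input prefix $a(b_1,\dots,b_n)$ and every output prefix $\overline a\langle b_1,\dots,b_n\rangle$ in it, $a$ has some sort $s$ such that $\mathtt{ob}(s)$ is the sequence of sorts of $b_1,\dots,b_n$. Actions: $(\nu\tilde y')\overline z\langle\tilde y\rangle$ with $\tilde y'\subseteq\tilde y$ distinct and $z\notin\tilde y'$ (the order of the bound names $\tilde y'$ is immaterial), $x\langle\tilde z\rangle$, $\tau$. Rules (symmetric ones included): $\overline x\langle\tilde y\rangle.P\xrightarrow{\overline x\langle\tilde y\rangle}P$; $x(\tilde y).P\xrightarrow{x\langle\tilde z\rangle}P\{\tilde z/\tilde y\}$ if $\tilde z,\tilde y$ have the same sequence of sorts; $P\xrightarrow\beta P'$ implies $P+Q\xrightarrow\beta P'$, $[x=x]P\xrightarrow\beta P'$, $P\mid Q\xrightarrow\beta P'\mid Q$ if $\mathrm{bn}(\beta)\cap\mathrm{fn}(Q)=\emptyset$, and $\nu x\,P\xrightarrow\beta\nu x\,P'$ if $x\notin\mathrm n(\beta)$; $P\mid{!P}\xrightarrow\beta P'$ implies $!P\xrightarrow\beta P'$; $P\xrightarrow{(\nu\tilde y')\overline x\langle\tilde y\rangle}P'$ and $Q\xrightarrow{x\langle\tilde y\rangle}Q'$ with $\tilde y'\cap\mathrm{fn}(Q)=\emptyset$ imply $P\mid Q\xrightarrow\tau\nu\tilde y'(P'\mid Q')$; $P\xrightarrow{(\nu\tilde y')\overline z\langle\tilde y\rangle}P'$ with $x\ne z$, $x\in\tilde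 y\setminus\tilde y'$ implies $\nu x\,P\xrightarrow{(\nu x,\tilde y')\overline z\langle\tilde y\rangle}P'$. *)

theory Defs
  imports "HOL-Library.Countable" "HOL-Combinatorics.Permutations"
begin

section \<open>Sorted names\<close>

text \<open>The subject sorts are the elements of a type \<open>'s\<close>; each of them has countably many names.\<close>

datatype 's name = Name (sort_of: 's) nat

definition sperm :: "('s name \<Rightarrow> 's name) \<Rightarrow> bool" where
  "sperm p \<longleftrightarrow> bij p \<and> finite {a. p a \<noteq> a} \<and> (\<forall>a. sort_of (p a) = sort_of a)"

text \<open>Swappings preserve sorts: swapping names of different sorts does nothing.\<close>

definition swp :: "'s name \<Rightarrow> 's name \<Rightarrow> 's name \<Rightarrow> 's name" where
  "swp a b = (if sort_of a = sort_of b then transpose a b else id)"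

text \<open>
  Simultaneous capture-avoiding substitution is defined on raw syntax with the help of a
  renaming of the bound names \<open>A\<close> that keeps them distinct and avoids the names \<open>B\<close>.
\<close>

definition fresh_renaming :: "'s name set \<Rightarrow> 's name set \<Rightarrow> 's name \<Rightarrow> 's name" where
  "fresh_renaming A B =
     (SOME r. inj_on r A \<and> (\<forall>a\<in>A. sort_of (r a) = sort_of a) \<and> r ` A \<inter> B = {})"

definition name_subst :: "'s name list \<Rightarrow> 's name list \<Rightarrow> 's name \<Rightarrow> 's name" where
  "name_subst xs ls a = (case map_of (zip xs ls) a of None \<Rightarrow> a | Some b \<Rightarrow> b)"

lemma sperm_inj: "sperm p \<Longrightarrow> inj p"
  by (simp add: sperm_def bij_is_inj)

lemma sperm_eq_iff: "sperm p \<Longrightarrow> p a = p b \<longleftrightarrow> a = b"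
  by (meson sperm_inj inj_eq)

lemma sperm_id: "sperm id"
  by (simp add: sperm_def)

lemma sperm_comp:
  assumes "sperm p" "sperm q"
  shows "sperm (p \<circ> q)"
proof -
  have "{a. (p \<circ> q) a \<noteq> a} \<subseteq> {a. p a \<noteq> a} \<union> {a. q a \<noteq> a}"
    by auto
  then have "finite {a. (p \<circ> q) a \<noteq> a}"
    by (rule finite_subset) (use assms in \<open>simp add: sperm_def\<close>)
  then show ?thesis
    using assms by (simp add: sperm_def bij_comp)
qed

lemma sperm_inv:
  assumes "sperm p"
  shows "sperm (inv p)"
proof -
  have b: "bij p"
    using assms by (simp add: sperm_def)
  have "inv p a = a \<longleftrightarrow> p a = a" for a
    using bij_inv_eq_iff[OF b, of a a] by auto
  then have "{a. inv p a \<noteq> a} = {a. p a \<noteq> a}"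
    by simp
  moreover have "sort_of (inv p a) = sort_of a" for a
  proof -
    have "sort_of (p (inv p a)) = sort_of (inv p a)"
      using assms by (simp add: sperm_def)
    then show ?thesis
      using b by (simp add: bij_is_surj surj_f_inv_f)
  qed
  ultimately show ?thesis
    using assms b by (simp add: sperm_def bij_imp_bij_inv)
qed

lemma sperm_swp: "sperm (swp a b)"
proof -
  have "{c. transpose a b c \<noteq> c} \<subseteq> {a, b}"
    by (auto simp: transpose_def)
  then have "finite {c. transpose a b c \<noteq> c}"
    by (rule finite_subset) simp
  then show ?thesis
    by (auto simp: sperm_def swp_def transpose_def)
qed

lemma sperm_extend:
  assumes "finite A" "inj_on f A" "\<And>a. a \<in> A \<Longrightarrow> sort_of (f a) = sort_of a"
  shows "\<exists>p. sperm p \<and> (\<forall>a\<in>A. p a = f a) \<and> (\<forall>a. a \<notin> A \<union> f ` A \<longrightarrow> p a = a)"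
  using assms
proof (induction A rule: finite_induct)
  case empty
  show ?case
    using sperm_id by auto
next
  case (insert x A)
  then obtain p where p: "sperm p" "\<And>a. a \<in> A \<Longrightarrow> p a = f a"
    "\<And>a. a \<notin> A \<union> f ` A \<Longrightarrow> p a = a"
    using insert.IH by auto
  let ?q = "swp (p x) (f x) \<circ> p"
  have s: "sort_of (p x) = sort_of (f x)"
    using insert.prems(2) p(1) by (simp add: sperm_def)
  have sw: "swp (p x) (f x) c = (if c = p x then f x else if c = f x then p x else c)" for c
    using s by (simp add: swp_def transpose_def)
  have "?q a = f a" if "a \<in> insert x A" for a
  proof (cases "a = x")
    case False
    then have "a \<in> A"
      using that by simp
    moreover have "p a \<noteq> p x"
      using False p(1) by (simp add: sperm_eq_iff)
    moreover have "f a \<noteq> f x"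
      using inj_onD[OF insert.prems(1), of a x] that False by auto
    ultimately show ?thesis
      using p(2) by (simp add: sw)
  qed (simp add: sw)
  moreover have "?q a = a" if a: "a \<notin> insert x A \<union> f ` insert x A" for a
  proof -
    have "p a = a"
      using a p(3) by simp
    moreover have "a \<noteq> p x"
      using a \<open>p a = a\<close> sperm_eq_iff[OF p(1), of a x] by auto
    ultimately show ?thesis
      using a by (simp add: sw)
  qed
  ultimately show ?case
    using sperm_comp[OF sperm_swp p(1)] by blast
qed

lemma fresh_renaming_exists:
  fixes A B :: "'s name set"
  assumes "finite A" "finite B"
  shows "\<exists>r. inj_on r A \<and> (\<forall>a\<in>A. sort_of (r a) = sort_of a) \<and> r ` A \<inter> B = {}"
proof -
  define idx :: "'s name \<Rightarrow> nat" where "idx a = (case a of Name s n \<Rightarrow> n)" for a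
  have "finite (idx ` B)"
    using assms(2) by simp
  then obtain m where m: "\<And>b. b \<in> B \<Longrightarrow> idx b < m"
    unfolding finite_nat_set_iff_bounded by auto
  let ?r = "\<lambda>a. Name (sort_of a) (idx a + m)"
  have "inj_on ?r A"
    by (auto simp: inj_on_def idx_def split: name.splits)
  moreover have "?r ` A \<inter> B = {}"
    using m by (force simp: idx_def)
  ultimately show ?thesis
    by (intro exI[of _ ?r]) simp
qed

lemma fresh_renaming:
  assumes "finite A" "finite B"
  shows "inj_on (fresh_renaming A B) A"
    "\<And>a. a \<in> A \<Longrightarrow> sort_of (fresh_renaming A B a) = sort_of a"
    "fresh_renaming A B ` A \<inter> B = {}"
  using someI_ex[OF fresh_renaming_exists[OF assms]] unfolding fresh_renaming_def[symmetric] by auto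

text \<open>Two different choices of fresh bound names are related by a permutation.\<close>

lemma fresh_match:
  assumes fin: "finite A" and k: "sperm k" and p: "sperm p"
    and r: "inj_on r A" "\<And>a. a \<in> A \<Longrightarrow> sort_of (r a) = sort_of a"
    and q: "inj_on q (p ` A)" "\<And>a. a \<in> p ` A \<Longrightarrow> sort_of (q a) = sort_of a"
    and B: "k ` r ` A \<inter> B = {}" "q ` p ` A \<inter> B = {}"
  shows "\<exists>h. sperm h \<and> (\<forall>a\<in>A. h (k (r a)) = q (p a)) \<and> (\<forall>b\<in>B. h b = b)"
proof -
  define f where "f c = q (p (inv_into A r (inv k c)))" for c
  have f: "f (k (r a)) = q (p a)" if "a \<in> A" for a
    using that r(1) sperm_inj[OF k] by (simp add: f_def)
  have "inj_on f (k ` r ` A)"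
  proof (rule inj_onI)
    fix c d
    assume "c \<in> k ` r ` A" "d \<in> k ` r ` A" and e: "f c = f d"
    then obtain a b where a: "a \<in> A" "c = k (r a)" and b: "b \<in> A" "d = k (r b)"
      by auto
    then have "q (p a) = q (p b)"
      using e f by simp
    then show "c = d"
      using a b q(1) p by (auto simp: inj_on_def sperm_eq_iff)
  qed
  moreover have "sort_of (f c) = sort_of c" if "c \<in> k ` r ` A" for c
    using that f r(2) q(2) k p by (auto simp: sperm_def)
  ultimately have "\<exists>h. sperm h \<and> (\<forall>a\<in>k ` r ` A. h a = f a) \<and>
      (\<forall>a. a \<notin> k ` r ` A \<union> f ` k ` r ` A \<longrightarrow> h a = a)"
    using fin by (intro sperm_extend) auto
  then obtain h where h: "sperm h" "\<forall>a\<in>k ` r ` A. h a = f a"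
    "\<forall>a. a \<notin> k ` r ` A \<union> f ` k ` r ` A \<longrightarrow> h a = a"
    by (elim exE conjE)
  have "f ` k ` r ` A = q ` p ` A"
    by (simp add: image_image f cong: image_cong)
  moreover have "b \<notin> k ` r ` A" "b \<notin> q ` p ` A" if "b \<in> B" for b
    using B that unfolding disjoint_iff by blast+
  ultimately have "h b = b" if "b \<in> B" for b
    using h(3) that by (metis UnE)
  moreover have "h (k (r a)) = q (p a)" if "a \<in> A" for a
    using h(2) that by (simp add: f)
  ultimately show ?thesis
    using h(1) by auto
qed

lemma override_image_diff:
  assumes "finite A" "finite S" "t = override_on f (fresh_renaming A (f ` (S - A))) A"
  shows "t ` S - t ` A = f ` (S - A)"
proof -
  let ?r = "fresh_renaming A (f ` (S - A))"
  have "t ` A = ?r ` A" "t ` (S - A) = f ` (S - A)"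
    by (auto simp: assms(3) override_on_def)
  moreover have "?r ` A \<inter> f ` (S - A) = {}"
    using assms by (intro fresh_renaming) auto
  moreover have "t ` S - t ` A = t ` (S - A) - t ` A"
    by auto
  ultimately show ?thesis
    by auto
qed

lemma binder_match:
  assumes fin: "finite A" "finite S" and k: "sperm k" and p: "sperm p"
    and eq: "\<And>a. a \<in> S - A \<Longrightarrow> k (f a) = g (p a)"
    and f': "f' = override_on f (fresh_renaming A (f ` (S - A))) A"
    and g': "g' = override_on g (fresh_renaming (p ` A) (g ` (p ` S - p ` A))) (p ` A)"
  shows "\<exists>h. sperm h \<and> (\<forall>x\<in>S \<union> A. h (k (f' x)) = g' (p x)) \<and>
    (\<forall>b\<in>k ` f' ` S - k ` f' ` A. h b = b)"
proof -
  let ?r = "fresh_renaming A (f ` (S - A))"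
  let ?q = "fresh_renaming (p ` A) (g ` (p ` S - p ` A))"
  let ?B = "k ` f ` (S - A)"
  have B: "?B = g ` (p ` S - p ` A)"
    using eq by (force simp: image_image image_set_diff[OF sperm_inj[OF p], symmetric])
  note r = fresh_renaming[of A "f ` (S - A)"] and q = fresh_renaming[of "p ` A" "g ` (p ` S - p ` A)"]
  have "k ` ?r ` A \<inter> ?B = k ` (?r ` A \<inter> f ` (S - A))"
    by (simp add: image_Int[OF sperm_inj[OF k]])
  also have "\<dots> = {}"
    using r(3) fin by simp
  finally have "\<exists>h. sperm h \<and> (\<forall>a\<in>A. h (k (?r a)) = ?q (p a)) \<and> (\<forall>b\<in>?B. h b = b)"
    using fin q r by (intro fresh_match k p) (simp_all add: B)
  then obtain h where h: "sperm h" "\<And>a. a \<in> A \<Longrightarrow> h (k (?r a)) = ?q (p a)"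
    "\<And>b. b \<in> ?B \<Longrightarrow> h b = b"
    by blast
  have "h (k (f' x)) = g' (p x)" if "x \<in> S \<union> A" for x
  proof (cases "x \<in> A")
    case True
    then show ?thesis
      by (simp add: f' g' h(2))
  next
    case False
    then have "p x \<notin> p ` A" "x \<in> S - A"
      using that p by (auto simp: sperm_eq_iff)
    moreover have "h (k (f x)) = k (f x)"
      using \<open>x \<in> S - A\<close> by (intro h(3)) blast
    ultimately show ?thesis
      using False eq[of x] by (simp add: f' g')
  qed
  moreover have "k ` f' ` S - k ` f' ` A = ?B"
    using override_image_diff[OF fin f'] by (simp add: image_set_diff[OF sperm_inj[OF k], symmetric])
  ultimately show ?thesis
    using h by auto
qed

section \<open>The psi-calculus SORTEDPPI: data\<close>

text \<open>
  The calculus depends only on the partial function \<open>ob\<close>, which enters through well-formedness.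
  All syntax is parametrised by the type of names, so that \<open>set_\<close> gives the support and
  \<open>map_\<close> the action of a permutation.
\<close>

datatype 'n tm = Nm 'n | Tup "'n list"

datatype 'n cond = Top | Bot | Eq 'n 'n

datatype assertion = One

datatype 'n pat = PTup "'n list"

datatype 's srt = SName 's | STup "'s list"

fun sort_tm :: "'s name tm \<Rightarrow> 's srt" where
  "sort_tm (Nm a) = SName (sort_of a)"
| "sort_tm (Tup as) = STup (map sort_of as)"

fun sort_pat :: "'s name pat \<Rightarrow> 's srt" where
  "sort_pat (PTup as) = STup (map sort_of as)"

fun distinct_pat :: "'n pat \<Rightarrow> bool" where
  "distinct_pat (PTup as) = distinct as"

fun entails :: "assertion \<Rightarrow> 'n cond \<Rightarrow> bool" where
  "entails One Top = True"
| "entails One Bot = False"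
| "entails One (Eq a b) = (a = b)"

fun chan_eq :: "'n tm \<Rightarrow> 'n tm \<Rightarrow> 'n cond" where
  "chan_eq (Nm a) (Nm b) = Eq a b"
| "chan_eq _ _ = Bot"

text \<open>Only names occur in the tuples \<open>L\<close> that \<open>Match\<close> returns, so we take them to be lists of names.\<close>

definition Match :: "'s name tm \<Rightarrow> 's name list \<Rightarrow> 's name pat \<Rightarrow> 's name list set" where
  "Match N xs X =
     {permute_list p as | p as ys. N = Tup as \<and> X = PTup ys \<and> p permutes {..<length ys} \<and>
        xs = permute_list p ys \<and> sort_tm (Tup as) = sort_tm (Tup ys)}"

text \<open>A subject of sort \<open>s\<close> may carry objects (and patterns) of sort \<open>t\<close>.\<close>

fun can_carry :: "('s \<rightharpoonup> 's list) \<Rightarrow> 's srt \<Rightarrow> 's srt \<Rightarrow> bool" where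
  "can_carry ob (SName s) t = (\<exists>ss. ob s = Some ss \<and> t = STup ss)"
| "can_carry ob (STup _) t = False"

section \<open>Agents\<close>

subsection \<open>Raw agents and alpha-equivalence\<close>

datatype 'n ragent =
    ROut "'n tm" "'n tm" "'n ragent"
  | RIn "'n tm" "'n list" "'n pat" "'n ragent"
  | RCase "('n cond \<times> 'n ragent) list"
  | RRes 'n "'n ragent"
  | RPar "'n ragent" "'n ragent"
  | RRep "'n ragent"
  | RAssert assertion

fun rfn :: "'n ragent \<Rightarrow> 'n set" where
  "rfn (ROut M N P) = set_tm M \<union> set_tm N \<union> rfn P"
| "rfn (RIn M xs X P) = set_tm M \<union> ((set_pat X \<union> rfn P) - set xs)"
| "rfn (RCase Cs) = (\<Union>c\<in>set Cs. set_cond (fst c) \<union> rfn (snd c))"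
| "rfn (RRes a P) = rfn P - {a}"
| "rfn (RPar P Q) = rfn P \<union> rfn Q"
| "rfn (RRep P) = rfn P"
| "rfn (RAssert \<Psi>) = {}"

inductive ralpha :: "'s name ragent \<Rightarrow> 's name ragent \<Rightarrow> bool" where
  Out: "ralpha P Q \<Longrightarrow> ralpha (ROut M N P) (ROut M N Q)"
| In: "\<lbrakk>sperm p; \<And>a. a \<in> (set_pat X \<union> rfn P) - set xs \<Longrightarrow> p a = a; ralpha (map_ragent p P) Q\<rbrakk> \<Longrightarrow>
    ralpha (RIn M xs X P) (RIn M (map p xs) (map_pat p X) Q)"
| Case: "list_all2 (rel_prod (=) ralpha) Cs Ds \<Longrightarrow> ralpha (RCase Cs) (RCase Ds)"
| Res: "\<lbrakk>sperm p; \<And>b. b \<in> rfn P - {a} \<Longrightarrow> p b = b; ralpha (map_ragent p P) Q\<rbrakk> \<Longrightarrow>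
    ralpha (RRes a P) (RRes (p a) Q)"
| Par: "\<lbrakk>ralpha P P'; ralpha Q Q'\<rbrakk> \<Longrightarrow> ralpha (RPar P Q) (RPar P' Q')"
| Rep: "ralpha P Q \<Longrightarrow> ralpha (RRep P) (RRep Q)"
| Assert: "ralpha (RAssert \<Psi>) (RAssert \<Psi>)"
monos list.rel_mono_strong prod.rel_mono_strong

text \<open>No unguarded assertions.\<close>

fun rguarded :: "'n ragent \<Rightarrow> bool" where
  "rguarded (ROut M N P) = True"
| "rguarded (RIn M xs X P) = True"
| "rguarded (RCase Cs) = (\<forall>c\<in>set Cs. rguarded (snd c))"
| "rguarded (RRes a P) = rguarded P"
| "rguarded (RPar P Q) = (rguarded P \<and> rguarded Q)"
| "rguarded (RRep P) = rguarded P"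
| "rguarded (RAssert \<Psi>) = False"

fun rwf :: "('s \<rightharpoonup> 's list) \<Rightarrow> 's name ragent \<Rightarrow> bool" where
  "rwf ob (ROut M N P) = (can_carry ob (sort_tm M) (sort_tm N) \<and> rwf ob P)"
| "rwf ob (RIn M xs X P) =
    (can_carry ob (sort_tm M) (sort_pat X) \<and> distinct_pat X \<and>
     distinct xs \<and> set xs = set_pat X \<and> rwf ob P)"
| "rwf ob (RCase Cs) = (\<forall>c\<in>set Cs. rguarded (snd c) \<and> rwf ob (snd c))"
| "rwf ob (RRes a P) = rwf ob P"
| "rwf ob (RPar P Q) = (rwf ob P \<and> rwf ob Q)"
| "rwf ob (RRep P) = (rguarded P \<and> rwf ob P)"
| "rwf ob (RAssert \<Psi>) = True"

text \<open>
  Substitution along an arbitrary map on names. Bound names are first renamed away from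
  everything that could be captured; in well-formed agents all names of a pattern are bound, so
  a pattern is changed only by this renaming.
\<close>

fun rsubst :: "('s name \<Rightarrow> 's name) \<Rightarrow> 's name ragent \<Rightarrow> 's name ragent" where
  "rsubst \<sigma> (ROut M N P) = ROut (map_tm \<sigma> M) (map_tm \<sigma> N) (rsubst \<sigma> P)"
| "rsubst \<sigma> (RIn M xs X P) =
    (let r = fresh_renaming (set xs) (\<sigma> ` ((set_pat X \<union> rfn P) - set xs));
         \<tau> = override_on \<sigma> r (set xs)
     in RIn (map_tm \<sigma> M) (map \<tau> xs) (map_pat \<tau> X) (rsubst \<tau> P))"
| "rsubst \<sigma> (RCase Cs) = RCase (map (\<lambda>c. (map_cond \<sigma> (fst c), rsubst \<sigma> (snd c))) Cs)"
| "rsubst \<sigma> (RRes a P) =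
    (let r = fresh_renaming {a} (\<sigma> ` (rfn P - {a}));
         \<tau> = override_on \<sigma> r {a}
     in RRes (\<tau> a) (rsubst \<tau> P))"
| "rsubst \<sigma> (RPar P Q) = RPar (rsubst \<sigma> P) (rsubst \<sigma> Q)"
| "rsubst \<sigma> (RRep P) = RRep (rsubst \<sigma> P)"
| "rsubst \<sigma> (RAssert \<Psi>) = RAssert \<Psi>"

lemma finite_rfn: "finite (rfn P)"
proof (induction P)
  case (RIn M xs X P)
  then show ?case
    by (cases M; cases X) auto
next
  case (ROut M N P)
  then show ?case
    by (cases M; cases N) auto
next
  case (RCase Cs)
  have "finite (set_cond \<phi>)" for \<phi> :: "'a cond"
    by (cases \<phi>) auto
  then show ?case
    using RCase by (auto simp: snds.simps)
qed auto

lemma rfn_map: "inj p \<Longrightarrow> rfn (map_ragent p P) = p ` rfn P"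
proof (induction P)
  case (RIn M xs X P)
  then show ?case
    by (simp add: tm.set_map pat.set_map image_Un image_set_diff)
next
  case (RCase Cs)
  have "set_cond (map_cond p (fst c)) \<union> rfn (map_ragent p (snd c)) =
      p ` (set_cond (fst c) \<union> rfn (snd c))" if "c \<in> set Cs" for c
    using RCase that by (simp add: cond.set_map image_Un snds.intros)
  then show ?case
    by (simp add: image_UN fst_map_prod snd_map_prod)
next
  case (RRes a P)
  then show ?case
    by (simp add: image_set_diff)
qed (simp_all add: tm.set_map image_Un)

lemma ralpha_rfn: "ralpha P Q \<Longrightarrow> rfn P = rfn Q"
proof (induction rule: ralpha.induct)
  case (In p X P xs Q M)
  have "rfn Q = p ` rfn P"
    using In.IH rfn_map[OF sperm_inj[OF In.hyps(1)], of P] by simp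
  then have "(set_pat (map_pat p X) \<union> rfn Q) - set (map p xs) = p ` ((set_pat X \<union> rfn P) - set xs)"
    by (simp add: pat.set_map image_Un image_set_diff[OF sperm_inj[OF In.hyps(1)]])
  also have "\<dots> = (set_pat X \<union> rfn P) - set xs"
    by (rule trans[OF image_cong[OF refl] image_ident]) (rule In.hyps(2))
  finally show ?case
    by simp
next
  case (Case Cs Ds)
  have "(\<Union>c\<in>set Cs. set_cond (fst c) \<union> rfn (snd c)) =
      (\<Union>c\<in>set Ds. set_cond (fst c) \<union> rfn (snd c))"
    using Case by (induction rule: list_all2_induct) (auto simp: rel_prod_sel)
  then show ?case
    by simp
next
  case (Res p P a Q)
  have "rfn Q = p ` rfn P"
    using Res.IH rfn_map[OF sperm_inj[OF Res.hyps(1)], of P] by simp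
  then have "rfn Q - {p a} = p ` (rfn P - {a})"
    by (simp add: image_set_diff[OF sperm_inj[OF Res.hyps(1)]])
  also have "\<dots> = rfn P - {a}"
    by (rule trans[OF image_cong[OF refl] image_ident]) (rule Res.hyps(2))
  finally show ?case
    by simp
qed auto

lemma sperm_conj:
  assumes "sperm k" "sperm p"
  shows "sperm (k \<circ> p \<circ> inv k)" "(k \<circ> p \<circ> inv k) \<circ> k = k \<circ> p" "(k \<circ> p \<circ> inv k) (k a) = k (p a)"
proof -
  have *: "inv k (k x) = x" for x
    using sperm_inj[OF assms(1)] by simp
  show "sperm (k \<circ> p \<circ> inv k)"
    using assms by (intro sperm_comp sperm_inv)
  show "(k \<circ> p \<circ> inv k) \<circ> k = k \<circ> p" "(k \<circ> p \<circ> inv k) (k a) = k (p a)"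
    by (auto simp: fun_eq_iff *)
qed

lemma ralpha_perm:
  assumes "ralpha P Q" "sperm k"
  shows "ralpha (map_ragent k P) (map_ragent k Q)"
  using assms
proof (induction rule: ralpha.induct)
  case (In p X P xs Q M)
  let ?p = "k \<circ> p \<circ> inv k"
  note c = sperm_conj[OF In.prems In.hyps(1)]
  have "?p b = b" if "b \<in> (set_pat (map_pat k X) \<union> rfn (map_ragent k P)) - set (map k xs)" for b
  proof -
    have "b \<in> k ` ((set_pat X \<union> rfn P) - set xs)"
      using that rfn_map[OF sperm_inj[OF In.prems], of P] by (auto simp: pat.set_map)
    then obtain a where a: "b = k a" "a \<in> (set_pat X \<union> rfn P) - set xs"
      by blast
    then show ?thesis
      using In.hyps(2)[OF a(2)] c(3) by simp
  qed
  moreover have "ralpha (map_ragent ?p (map_ragent k P)) (map_ragent k Q)"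
    using In.IH In.prems by (simp add: ragent.map_comp c)
  ultimately have "ralpha (RIn (map_tm k M) (map k xs) (map_pat k X) (map_ragent k P))
      (RIn (map_tm k M) (map ?p (map k xs)) (map_pat ?p (map_pat k X)) (map_ragent k Q))"
    using c(1) by (intro ralpha.In)
  then show ?case
    by (simp only: ragent.map pat.map_comp list.map_comp c(2))
next
  case (Case Cs Ds)
  then have "list_all2 (rel_prod (=) ralpha) (map (map_prod (map_cond k) (map_ragent k)) Cs)
      (map (map_prod (map_cond k) (map_ragent k)) Ds)"
    unfolding list.rel_map by (auto simp: rel_prod_sel elim!: list_all2_mono)
  then show ?case
    by (simp add: ralpha.Case)
next
  case (Res p P a Q)
  let ?p = "k \<circ> p \<circ> inv k"
  note c = sperm_conj[OF Res.prems Res.hyps(1)]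
  have "?p b = b" if "b \<in> rfn (map_ragent k P) - {k a}" for b
  proof -
    have "b \<in> k ` rfn P" "b \<noteq> k a"
      using that by (simp_all add: rfn_map[OF sperm_inj[OF Res.prems]])
    then obtain d where d: "b = k d" "d \<in> rfn P - {a}"
      by blast
    then show ?thesis
      using Res.hyps(2)[OF d(2)] c(3) by simp
  qed
  moreover have "ralpha (map_ragent ?p (map_ragent k P)) (map_ragent k Q)"
    using Res.IH Res.prems by (simp add: ragent.map_comp c)
  ultimately have "ralpha (RRes (k a) (map_ragent k P)) (RRes (?p (k a)) (map_ragent k Q))"
    using c(1) by (intro ralpha.Res)
  then show ?case
    by (simp only: ragent.map c(3))
qed (auto intro: ralpha.intros)

lemma ralpha_refl: "ralpha P P"
proof (induction P)
  case (RIn M xs X P)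
  then show ?case
    using ralpha.In[of id X P xs P M] sperm_id by (simp add: ragent.map_id pat.map_id)
next
  case (RCase Cs)
  then show ?case
    by (intro ralpha.Case) (auto simp: list.rel_refl_strong rel_prod_sel snds.intros
        intro!: list.rel_refl_strong)
next
  case (RRes a P)
  then show ?case
    using ralpha.Res[of id P a P] sperm_id by (simp add: ragent.map_id)
qed (auto intro: ralpha.intros)

lemma ralpha_In_cong: "ralpha P Q \<Longrightarrow> ralpha (RIn M xs X P) (RIn M xs X Q)"
  using ralpha.In[OF sperm_id, of X P xs Q M] by (simp add: ragent.map_id pat.map_id)

lemma ralpha_In_subject:
  "ralpha (RIn M xs X P) (RIn M' ys Y Q) \<Longrightarrow> ralpha (RIn N xs X P) (RIn N ys Y Q)"
  by (erule ralpha.cases) (auto intro: ralpha.In)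

lemma ralpha_Res_cong: "ralpha P Q \<Longrightarrow> ralpha (RRes a P) (RRes a Q)"
  using ralpha.Res[OF sperm_id, of P a Q] by (simp add: ragent.map_id)

lemma sperm_inv_comp: "sperm p \<Longrightarrow> inv p \<circ> p = id"
  by (simp add: sperm_inj)

lemma sperm_comp_inv: "sperm p \<Longrightarrow> p \<circ> inv p = id"
  by (simp add: sperm_def bij_is_surj surj_iff[symmetric])

lemma sperm_inv_apply: "sperm p \<Longrightarrow> inv p (p a) = a"
  by (simp add: sperm_inj)

lemma ralpha_sym: "ralpha P Q \<Longrightarrow> ralpha Q P"
proof (induction rule: ralpha.induct)
  case (In p X P xs Q M)
  have f: "(set_pat (map_pat p X) \<union> rfn Q) - set (map p xs) = (set_pat X \<union> rfn P) - set xs"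
    using ralpha_rfn[OF ralpha.In[OF In.hyps(1-3), where M = "Tup []"]] by simp
  have "ralpha (map_ragent (inv p) Q) P"
    using ralpha_perm[OF In.IH sperm_inv[OF In.hyps(1)]]
    by (simp add: ragent.map_comp sperm_inv_comp[OF In.hyps(1)] ragent.map_id)
  moreover have "inv p b = b" if "b \<in> (set_pat (map_pat p X) \<union> rfn Q) - set (map p xs)" for b
    using that In.hyps(2)[of b] sperm_inv_apply[OF In.hyps(1), of b] unfolding f by simp
  ultimately have "ralpha (RIn M (map p xs) (map_pat p X) Q)
      (RIn M (map (inv p) (map p xs)) (map_pat (inv p) (map_pat p X)) P)"
    using sperm_inv[OF In.hyps(1)] by (intro ralpha.In)
  then show ?case
    by (simp add: pat.map_comp sperm_inv_comp[OF In.hyps(1)] pat.map_id)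
next
  case (Case Cs Ds)
  then have "list_all2 (rel_prod (=) ralpha) Ds Cs"
    by (subst list.rel_flip[symmetric]) (auto simp: rel_prod_sel elim!: list_all2_mono)
  then show ?case
    by (rule ralpha.Case)
next
  case (Res p P a Q)
  have f: "rfn Q - {p a} = rfn P - {a}"
    using ralpha_rfn[OF ralpha.Res[OF Res.hyps(1-3)]] by simp
  have "ralpha (map_ragent (inv p) Q) P"
    using ralpha_perm[OF Res.IH sperm_inv[OF Res.hyps(1)]]
    by (simp add: ragent.map_comp sperm_inv_comp[OF Res.hyps(1)] ragent.map_id)
  moreover have "inv p b = b" if "b \<in> rfn Q - {p a}" for b
    using that Res.hyps(2)[of b] sperm_inv_apply[OF Res.hyps(1), of b] unfolding f by simp
  ultimately have "ralpha (RRes (p a) Q) (RRes (inv p (p a)) P)"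
    using sperm_inv[OF Res.hyps(1)] by (intro ralpha.Res)
  then show ?case
    by (simp add: sperm_inv_apply[OF Res.hyps(1)])
qed (auto intro: ralpha.intros)

lemma ralpha_trans: "ralpha P Q \<Longrightarrow> ralpha Q R \<Longrightarrow> ralpha P R"
proof (induction arbitrary: R rule: ralpha.induct)
  case (In p X P xs Q M)
  have f: "(set_pat (map_pat p X) \<union> rfn Q) - set (map p xs) = (set_pat X \<union> rfn P) - set xs"
    using ralpha_rfn[OF ralpha.In[OF In.hyps(1-3), where M = "Tup []"]] by simp
  from In.prems obtain q R' where q: "sperm q"
    "\<And>a. a \<in> (set_pat (map_pat p X) \<union> rfn Q) - set (map p xs) \<Longrightarrow> q a = a"
    "ralpha (map_ragent q Q) R'"
    and R: "R = RIn M (map q (map p xs)) (map_pat q (map_pat p X)) R'"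
    by (cases rule: ralpha.cases) auto
  have "ralpha Q (map_ragent (inv q) R')"
    using ralpha_perm[OF q(3) sperm_inv[OF q(1)]]
    by (simp add: ragent.map_comp sperm_inv_comp[OF q(1)] ragent.map_id)
  then have "ralpha (map_ragent p P) (map_ragent (inv q) R')"
    by (rule In.IH)
  then have "ralpha (map_ragent q (map_ragent p P)) (map_ragent q (map_ragent (inv q) R'))"
    using q(1) by (rule ralpha_perm)
  then have "ralpha (map_ragent (q \<circ> p) P) R'"
    by (simp add: ragent.map_comp sperm_comp_inv[OF q(1)] ragent.map_id)
  moreover have "(q \<circ> p) a = a" if "a \<in> (set_pat X \<union> rfn P) - set xs" for a
    using that In.hyps(2)[of a] q(2)[of a] unfolding f by simp
  ultimately have "ralpha (RIn M xs X P) (RIn M (map (q \<circ> p) xs) (map_pat (q \<circ> p) X) R')"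
    using sperm_comp[OF q(1) In.hyps(1)] by (intro ralpha.In)
  then show ?case
    by (simp add: R pat.map_comp)
next
  case (Case Cs Ds)
  from Case.prems obtain Es where R: "R = RCase Es" "list_all2 (rel_prod (=) ralpha) Ds Es"
    by (cases rule: ralpha.cases) auto
  have "list_all2 (rel_prod (=) ralpha) Cs Es"
    by (rule list_all2_trans[OF _ Case.IH R(2)]) (auto simp: rel_prod_sel)
  then show ?case
    by (simp add: R ralpha.Case)
next
  case (Res p P a Q)
  have f: "rfn Q - {p a} = rfn P - {a}"
    using ralpha_rfn[OF ralpha.Res[OF Res.hyps(1-3)]] by simp
  from Res.prems obtain q R' where q: "sperm q"
    "\<And>b. b \<in> rfn Q - {p a} \<Longrightarrow> q b = b" "ralpha (map_ragent q Q) R'"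
    and R: "R = RRes (q (p a)) R'"
    by (cases rule: ralpha.cases) auto
  have "ralpha Q (map_ragent (inv q) R')"
    using ralpha_perm[OF q(3) sperm_inv[OF q(1)]]
    by (simp add: ragent.map_comp sperm_inv_comp[OF q(1)] ragent.map_id)
  then have "ralpha (map_ragent p P) (map_ragent (inv q) R')"
    by (rule Res.IH)
  then have "ralpha (map_ragent q (map_ragent p P)) (map_ragent q (map_ragent (inv q) R'))"
    using q(1) by (rule ralpha_perm)
  then have "ralpha (map_ragent (q \<circ> p) P) R'"
    by (simp add: ragent.map_comp sperm_comp_inv[OF q(1)] ragent.map_id)
  moreover have "(q \<circ> p) b = b" if "b \<in> rfn P - {a}" for b
    using that Res.hyps(2)[of b] q(2)[of b] unfolding f by simp
  ultimately have "ralpha (RRes a P) (RRes ((q \<circ> p) a) R')"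
    using sperm_comp[OF q(1) Res.hyps(1)] by (intro ralpha.Res)
  then show ?case
    by (simp add: R)
next
  case (Out P Q M N)
  from Out.prems show ?case
    by (cases rule: ralpha.cases) (auto intro: ralpha.Out Out.IH)
next
  case (Par P P' Q Q')
  from Par.prems show ?case
    by (cases rule: ralpha.cases) (auto intro: ralpha.Par Par.IH)
next
  case (Rep P Q)
  from Rep.prems show ?case
    by (cases rule: ralpha.cases) (auto intro: ralpha.Rep Rep.IH)
qed

lemma rguarded_map: "rguarded (map_ragent p P) = rguarded P"
  by (induction P) (auto simp: snds.intros)

lemma ralpha_rguarded: "ralpha P Q \<Longrightarrow> rguarded P = rguarded Q"
proof (induction rule: ralpha.induct)
  case (Case Cs Ds)
  then show ?case
    by simp (induction rule: list_all2_induct, auto simp: rel_prod_sel)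
qed (auto simp: rguarded_map)

lemma sort_of_sperm: "sperm p \<Longrightarrow> sort_of (p a) = sort_of a"
  by (simp add: sperm_def)

lemma sort_tm_map: "sperm p \<Longrightarrow> sort_tm (map_tm p M) = sort_tm M"
  by (cases M) (simp_all add: sort_of_sperm)

lemma sort_pat_map: "sperm p \<Longrightarrow> sort_pat (map_pat p X) = sort_pat X"
  by (cases X) (simp_all add: sort_of_sperm)

lemma distinct_pat_map: "sperm p \<Longrightarrow> distinct_pat (map_pat p X) = distinct_pat X"
  by (cases X) (simp_all add: distinct_map inj_on_subset[OF sperm_inj])

lemma rwf_map: "sperm p \<Longrightarrow> rwf ob (map_ragent p P) = rwf ob P"
proof (induction P)
  case (RIn M xs X P)
  then show ?case
    by (simp add: sort_tm_map sort_pat_map distinct_pat_map distinct_map pat.set_map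
        inj_on_subset[OF sperm_inj] inj_image_eq_iff[OF sperm_inj])
qed (auto simp: snds.intros rguarded_map sort_tm_map)

lemma ralpha_rwf: "ralpha P Q \<Longrightarrow> rwf ob P = rwf ob Q"
proof (induction rule: ralpha.induct)
  case (In p X P xs Q M)
  then show ?case
    by (simp add: rwf_map sort_pat_map distinct_pat_map distinct_map pat.set_map
        inj_on_subset[OF sperm_inj] inj_image_eq_iff[OF sperm_inj])
next
  case (Case Cs Ds)
  then show ?case
    by simp (induction rule: list_all2_induct, auto simp: rel_prod_sel ralpha_rguarded)
qed (auto simp: rwf_map ralpha_rguarded)

lemma finite_set_tm: "finite (set_tm M)" "finite (set_pat X)"
  by (cases M; simp) (cases X; simp)

lemma rfn_rsubst: "rfn (rsubst \<sigma> P) = \<sigma> ` rfn P"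
proof (induction P arbitrary: \<sigma>)
  case (RIn M xs X P)
  let ?S = "set_pat X \<union> rfn P"
  define \<tau> where "\<tau> = override_on \<sigma> (fresh_renaming (set xs) (\<sigma> ` (?S - set xs))) (set xs)"
  have "\<tau> ` ?S - \<tau> ` set xs = \<sigma> ` (?S - set xs)"
    using \<tau>_def by (intro override_image_diff) (simp_all add: finite_rfn finite_set_tm)
  then show ?case
    using RIn by (simp add: Let_def \<tau>_def[symmetric] tm.set_map pat.set_map image_Un)
next
  case (RCase Cs)
  then show ?case
    by (simp add: image_UN image_Un cond.set_map snds.intros)
next
  case (RRes a P)
  define \<tau> where "\<tau> = override_on \<sigma> (fresh_renaming {a} (\<sigma> ` (rfn P - {a}))) {a}"
  have "\<tau> ` rfn P - \<tau> ` {a} = \<sigma> ` (rfn P - {a})"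
    using \<tau>_def by (intro override_image_diff) (simp_all add: finite_rfn)
  moreover have "rsubst \<sigma> (RRes a P) = RRes (\<tau> a) (rsubst \<tau> P)"
    by (simp only: rsubst.simps Let_def \<tau>_def)
  ultimately show ?case
    by (simp add: RRes.IH del: rsubst.simps)
qed (simp_all add: tm.set_map image_Un)

lemma rsubst_perm:
  assumes "sperm k" "sperm p" "\<And>a. a \<in> rfn P \<Longrightarrow> k (\<sigma> a) = \<tau> (p a)"
  shows "ralpha (map_ragent k (rsubst \<sigma> P)) (rsubst \<tau> (map_ragent p P))"
  using assms
proof (induction P arbitrary: \<sigma> \<tau> k p)
  case (ROut M N P)
  have "map_tm k (map_tm \<sigma> M) = map_tm \<tau> (map_tm p M)" "map_tm k (map_tm \<sigma> N) = map_tm \<tau> (map_tm p N)"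
    using ROut.prems(3) by (auto simp: tm.map_comp intro!: tm.map_cong0)
  then show ?case
    using ROut by (auto intro: ralpha.Out)
next
  case (RIn M xs X P)
  let ?S = "set_pat X \<union> rfn P" and ?A = "set xs"
  define \<sigma>' where "\<sigma>' = override_on \<sigma> (fresh_renaming ?A (\<sigma> ` (?S - ?A))) ?A"
  define \<tau>' where "\<tau>' = override_on \<tau> (fresh_renaming (p ` ?A) (\<tau> ` (p ` ?S - p ` ?A))) (p ` ?A)"
  have "\<exists>h. sperm h \<and> (\<forall>x\<in>?S \<union> ?A. h (k (\<sigma>' x)) = \<tau>' (p x)) \<and>
      (\<forall>b\<in>k ` \<sigma>' ` ?S - k ` \<sigma>' ` ?A. h b = b)"
    by (rule binder_match[OF _ _ RIn.prems(1,2) _ \<sigma>'_def \<tau>'_def])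
      (use RIn.prems(3) in \<open>auto simp: finite_rfn finite_set_tm\<close>)
  then obtain h where h: "sperm h" "\<And>x. x \<in> ?S \<union> ?A \<Longrightarrow> h (k (\<sigma>' x)) = \<tau>' (p x)"
    "\<And>b. b \<in> k ` \<sigma>' ` ?S - k ` \<sigma>' ` ?A \<Longrightarrow> h b = b"
    by (elim exE conjE) (rule that, assumption, (erule (1) bspec)+)
  have M: "map_tm k (map_tm \<sigma> M) = map_tm \<tau> (map_tm p M)"
    using RIn.prems(3) by (auto simp: tm.map_comp intro!: tm.map_cong0)
  have "ralpha (map_ragent (h \<circ> k) (rsubst \<sigma>' P)) (rsubst \<tau>' (map_ragent p P))"
    using h(2) by (intro RIn.IH sperm_comp h(1) RIn.prems) simp
  then have "ralpha (map_ragent h (map_ragent k (rsubst \<sigma>' P))) (rsubst \<tau>' (map_ragent p P))"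
    by (simp add: ragent.map_comp)
  moreover have "h b = b" if "b \<in> (set_pat (map_pat k (map_pat \<sigma>' X)) \<union> rfn (map_ragent k (rsubst \<sigma>' P)))
      - set (map k (map \<sigma>' xs))" for b
    by (rule h(3)) (use that in \<open>simp add: rfn_map[OF sperm_inj[OF RIn.prems(1)]] rfn_rsubst
        pat.set_map image_Un image_image\<close>)
  ultimately have "ralpha (RIn (map_tm k (map_tm \<sigma> M)) (map k (map \<sigma>' xs)) (map_pat k (map_pat \<sigma>' X))
        (map_ragent k (rsubst \<sigma>' P)))
      (RIn (map_tm k (map_tm \<sigma> M)) (map h (map k (map \<sigma>' xs))) (map_pat h (map_pat k (map_pat \<sigma>' X)))
        (rsubst \<tau>' (map_ragent p P)))"
    using h(1) by (intro ralpha.In)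
  moreover have "map h (map k (map \<sigma>' xs)) = map \<tau>' (map p xs)"
    using h(2) by simp
  moreover have "map_pat h (map_pat k (map_pat \<sigma>' X)) = map_pat \<tau>' (map_pat p X)"
    using h(2) by (auto simp: pat.map_comp intro!: pat.map_cong0)
  moreover have "rsubst \<tau> (map_ragent p (RIn M xs X P)) =
      RIn (map_tm \<tau> (map_tm p M)) (map \<tau>' (map p xs)) (map_pat \<tau>' (map_pat p X)) (rsubst \<tau>' (map_ragent p P))"
    by (simp add: Let_def \<tau>'_def rfn_map[OF sperm_inj[OF RIn.prems(2)]] pat.set_map image_Un)
  moreover have "rsubst \<sigma> (RIn M xs X P) =
      RIn (map_tm \<sigma> M) (map \<sigma>' xs) (map_pat \<sigma>' X) (rsubst \<sigma>' P)"
    by (simp only: rsubst.simps Let_def \<sigma>'_def)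
  ultimately show ?case
    by (simp only: ragent.map M)
next
  case (RCase Cs)
  have "map_cond k (map_cond \<sigma> (fst c)) = map_cond \<tau> (map_cond p (fst c)) \<and>
      ralpha (map_ragent k (rsubst \<sigma> (snd c))) (rsubst \<tau> (map_ragent p (snd c)))" if "c \<in> set Cs" for c
  proof -
    have "k (\<sigma> a) = \<tau> (p a)" if "a \<in> set_cond (fst c) \<union> rfn (snd c)" for a
      by (rule RCase.prems(3)) (use \<open>c \<in> set Cs\<close> that in auto)
    then show ?thesis
      using that by (auto simp: cond.map_comp intro!: cond.map_cong0 RCase.IH[OF that snds.intros] RCase.prems(1,2))
  qed
  then have "list_all2 (rel_prod (=) ralpha)
      (map (map_prod (map_cond k) (map_ragent k)) (map (\<lambda>c. (map_cond \<sigma> (fst c), rsubst \<sigma> (snd c))) Cs))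
      (map (\<lambda>c. (map_cond \<tau> (fst c), rsubst \<tau> (snd c))) (map (map_prod (map_cond p) (map_ragent p)) Cs))"
    by (auto simp: list.rel_map intro!: list.rel_refl_strong)
  then show ?case
    by (simp add: ralpha.Case)
next
  case (RRes a P)
  define \<sigma>' where "\<sigma>' = override_on \<sigma> (fresh_renaming {a} (\<sigma> ` (rfn P - {a}))) {a}"
  define \<tau>' where "\<tau>' = override_on \<tau> (fresh_renaming (p ` {a}) (\<tau> ` (p ` rfn P - p ` {a}))) (p ` {a})"
  have "\<exists>h. sperm h \<and> (\<forall>x\<in>rfn P \<union> {a}. h (k (\<sigma>' x)) = \<tau>' (p x)) \<and>
      (\<forall>b\<in>k ` \<sigma>' ` rfn P - k ` \<sigma>' ` {a}. h b = b)"
    by (rule binder_match[OF _ _ RRes.prems(1,2) _ \<sigma>'_def \<tau>'_def])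
      (use RRes.prems(3) in \<open>auto simp: finite_rfn\<close>)
  then obtain h where h: "sperm h" "\<And>x. x \<in> rfn P \<union> {a} \<Longrightarrow> h (k (\<sigma>' x)) = \<tau>' (p x)"
    "\<And>b. b \<in> k ` \<sigma>' ` rfn P - k ` \<sigma>' ` {a} \<Longrightarrow> h b = b"
    by (elim exE conjE) (rule that, assumption, (erule (1) bspec)+)
  have "ralpha (map_ragent (h \<circ> k) (rsubst \<sigma>' P)) (rsubst \<tau>' (map_ragent p P))"
    using h(2) by (intro RRes.IH sperm_comp h(1) RRes.prems) simp
  then have "ralpha (map_ragent h (map_ragent k (rsubst \<sigma>' P))) (rsubst \<tau>' (map_ragent p P))"
    by (simp add: ragent.map_comp)
  moreover have "h b = b" if "b \<in> rfn (map_ragent k (rsubst \<sigma>' P)) - {k (\<sigma>' a)}" for b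
    by (rule h(3)) (use that in \<open>simp add: rfn_map[OF sperm_inj[OF RRes.prems(1)]] rfn_rsubst\<close>)
  ultimately have "ralpha (RRes (k (\<sigma>' a)) (map_ragent k (rsubst \<sigma>' P)))
      (RRes (h (k (\<sigma>' a))) (rsubst \<tau>' (map_ragent p P)))"
    using h(1) by (intro ralpha.Res)
  moreover have "rsubst \<tau> (map_ragent p (RRes a P)) = RRes (\<tau>' (p a)) (rsubst \<tau>' (map_ragent p P))"
    by (simp only: ragent.map rsubst.simps Let_def \<tau>'_def rfn_map[OF sperm_inj[OF RRes.prems(2)]]
        image_insert image_empty)
  moreover have "rsubst \<sigma> (RRes a P) = RRes (\<sigma>' a) (rsubst \<sigma>' P)"
    by (simp only: rsubst.simps Let_def \<sigma>'_def)
  ultimately show ?case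
    using h(2)[of a] by (simp del: rsubst.simps)
qed (auto intro: ralpha.intros)

lemma ralpha_rsubst: "ralpha P Q \<Longrightarrow> ralpha (rsubst \<sigma> P) (rsubst \<sigma> Q)"
proof (induction arbitrary: \<sigma> rule: ralpha.induct)
  case (In p X P xs Q M)
  have "\<sigma> a = \<sigma> (p a)" if "a \<in> (set_pat X \<union> rfn P) - set xs" for a
    using In.hyps(2)[OF that] by simp
  then have "ralpha (rsubst \<sigma> (RIn (Tup []) xs X P)) (rsubst \<sigma> (map_ragent p (RIn (Tup []) xs X P)))"
    using rsubst_perm[OF sperm_id In.hyps(1), of "RIn (Tup []) xs X P" \<sigma> \<sigma>] by (simp add: ragent.map_id)
  then have "ralpha (rsubst \<sigma> (RIn M xs X P)) (rsubst \<sigma> (RIn M (map p xs) (map_pat p X) (map_ragent p P)))"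
    by (simp only: rsubst.simps Let_def ragent.map tm.map list.map) (rule ralpha_In_subject)
  moreover have "ralpha (rsubst \<sigma> (RIn M (map p xs) (map_pat p X) (map_ragent p P)))
      (rsubst \<sigma> (RIn M (map p xs) (map_pat p X) Q))"
    using In.IH ralpha_rfn[OF In.hyps(3)] by (simp add: Let_def ralpha_In_cong)
  ultimately show ?case
    by (rule ralpha_trans)
next
  case (Case Cs Ds)
  then show ?case
    by (auto simp: list.rel_map rel_prod_sel intro!: ralpha.Case elim!: list_all2_mono)
next
  case (Res p P a Q)
  have "\<sigma> b = \<sigma> (p b)" if "b \<in> rfn P - {a}" for b
    using Res.hyps(2)[OF that] by simp
  then have "ralpha (rsubst \<sigma> (RRes a P)) (rsubst \<sigma> (RRes (p a) (map_ragent p P)))"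
    using rsubst_perm[OF sperm_id Res.hyps(1), of "RRes a P" \<sigma> \<sigma>] by (simp add: ragent.map_id)
  moreover have "ralpha (rsubst \<sigma> (RRes (p a) (map_ragent p P))) (rsubst \<sigma> (RRes (p a) Q))"
    using Res.IH ralpha_rfn[OF Res.hyps(3)] by (simp add: Let_def ralpha_Res_cong)
  ultimately show ?case
    by (rule ralpha_trans)
qed (auto intro: ralpha.intros)


subsection \<open>Agents\<close>

quotient_type 's agent = "'s name ragent" / ralpha
  by (auto intro!: equivpI reflpI sympI transpI intro: ralpha_refl ralpha_sym ralpha_trans)

lift_definition Output :: "'s name tm \<Rightarrow> 's name tm \<Rightarrow> 's agent \<Rightarrow> 's agent" is ROut
  by (rule ralpha.Out)

lift_definition Input :: "'s name tm \<Rightarrow> 's name list \<Rightarrow> 's name pat \<Rightarrow> 's agent \<Rightarrow> 's agent" is RIn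
  by (rule ralpha_In_cong)

lift_definition Case :: "('s name cond \<times> 's agent) list \<Rightarrow> 's agent" is RCase
  by (rule ralpha.Case)

lift_definition Res :: "'s name \<Rightarrow> 's agent \<Rightarrow> 's agent" is RRes
  by (rule ralpha_Res_cong)

lift_definition Par :: "'s agent \<Rightarrow> 's agent \<Rightarrow> 's agent" is RPar
  by (rule ralpha.Par)

lift_definition Rep :: "'s agent \<Rightarrow> 's agent" is RRep
  by (rule ralpha.Rep)

lift_definition Assert :: "assertion \<Rightarrow> 's agent" is RAssert .

abbreviation Zero :: "'s agent" where
  "Zero \<equiv> Case []"

lift_definition fn :: "'s agent \<Rightarrow> 's name set" is rfn
  by (rule ralpha_rfn)

lift_definition guarded :: "'s agent \<Rightarrow> bool" is rguarded
  by (rule ralpha_rguarded)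

lift_definition wf_agent :: "('s \<rightharpoonup> 's list) \<Rightarrow> 's agent \<Rightarrow> bool" is rwf
  by (rule ralpha_rwf)

lift_definition swap_agent :: "'s name \<Rightarrow> 's name \<Rightarrow> 's agent \<Rightarrow> 's agent" is
  "\<lambda>a b. map_ragent (swp a b)"
  by (rule ralpha_perm[OF _ sperm_swp])

lift_definition subst_agent :: "('s name \<Rightarrow> 's name) \<Rightarrow> 's agent \<Rightarrow> 's agent" is rsubst
  by (rule ralpha_rsubst)

subsection \<open>Transitions\<close>

datatype 'n action = OutA "'n tm" "'n list" "'n tm" | InA "'n tm" "'n tm" | Tau

fun bn :: "'n action \<Rightarrow> 'n set" where
  "bn (OutA M as N) = set as"
| "bn _ = {}"

text \<open>
  The rule \<open>Alpha\<close> expresses that the bound names of an output action bind into the object and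
  the derivative (but not into the subject). As in \<open>Open\<close>, they are kept distinct from the
  names of the subject.
\<close>

inductive psi_trans :: "'s agent \<Rightarrow> 's name action \<Rightarrow> 's agent \<Rightarrow> bool" where
  In: "\<lbrakk>entails One (chan_eq M K); L \<in> Match N ys X\<rbrakk> \<Longrightarrow>
    psi_trans (Input M ys X P) (InA K N) (subst_agent (name_subst ys L) P)"
| Out: "entails One (chan_eq M K) \<Longrightarrow> psi_trans (Output M N P) (OutA K [] N) P"
| ComL: "\<lbrakk>psi_trans P (OutA M as N) P'; psi_trans Q (InA K N) Q';
     entails One (chan_eq M K); set as \<inter> fn Q = {}\<rbrakk> \<Longrightarrow>
    psi_trans (Par P Q) Tau (foldr Res as (Par P' Q'))"
| ComR: "\<lbrakk>psi_trans P (InA K N) P'; psi_trans Q (OutA M as N) Q';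
     entails One (chan_eq M K); set as \<inter> fn P = {}\<rbrakk> \<Longrightarrow>
    psi_trans (Par P Q) Tau (foldr Res as (Par P' Q'))"
| ParL: "\<lbrakk>psi_trans P \<alpha> P'; bn \<alpha> \<inter> fn Q = {}\<rbrakk> \<Longrightarrow> psi_trans (Par P Q) \<alpha> (Par P' Q)"
| ParR: "\<lbrakk>psi_trans Q \<alpha> Q'; bn \<alpha> \<inter> fn P = {}\<rbrakk> \<Longrightarrow> psi_trans (Par P Q) \<alpha> (Par P Q')"
| Case: "\<lbrakk>(\<phi>, P) \<in> set Cs; entails One \<phi>; psi_trans P \<alpha> P'\<rbrakk> \<Longrightarrow> psi_trans (Case Cs) \<alpha> P'"
| Rep: "psi_trans (Par P (Rep P)) \<alpha> P' \<Longrightarrow> psi_trans (Rep P) \<alpha> P'"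
| Scope: "\<lbrakk>psi_trans P \<alpha> P'; b \<notin> set_action \<alpha>\<rbrakk> \<Longrightarrow> psi_trans (Res b P) \<alpha> (Res b P')"
| Open: "\<lbrakk>psi_trans P (OutA M (as @ cs) N) P'; b \<notin> set (as @ cs) \<union> set_tm M; b \<in> set_tm N\<rbrakk> \<Longrightarrow>
    psi_trans (Res b P) (OutA M (as @ b # cs) N) P'"
| Alpha: "\<lbrakk>psi_trans P (OutA M as N) P'; c \<in> set as; sort_of d = sort_of c;
     d \<notin> set_tm M \<union> set_tm N \<union> fn P'\<rbrakk> \<Longrightarrow>
    psi_trans P (OutA M (map (swp c d) as) (map_tm (swp c d) N)) (swap_agent c d P')"

subsection \<open>Strong bisimulation congruence\<close>

text \<open>
  The requirement on frames is omitted: as there is only one assertion, all frames entail the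
  same conditions.
\<close>

definition bisimulation :: "('s \<rightharpoonup> 's list) \<Rightarrow> ('s agent \<Rightarrow> 's agent \<Rightarrow> bool) \<Rightarrow> bool" where
  "bisimulation ob R \<longleftrightarrow>
     (\<forall>P Q. R P Q \<longrightarrow> wf_agent ob P \<and> wf_agent ob Q) \<and> symp R \<and>
     (\<forall>P Q \<alpha> P'. R P Q \<longrightarrow> bn \<alpha> \<inter> fn Q = {} \<longrightarrow> psi_trans P \<alpha> P' \<longrightarrow>
        (\<exists>Q'. psi_trans Q \<alpha> Q' \<and> R P' Q'))"

definition bisimilar :: "('s \<rightharpoonup> 's list) \<Rightarrow> 's agent \<Rightarrow> 's agent \<Rightarrow> bool" where
  "bisimilar ob P Q \<longleftrightarrow> (\<exists>R. bisimulation ob R \<and> R P Q)"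

definition valid_subst :: "'s name list \<times> 's name list \<Rightarrow> bool" where
  "valid_subst = (\<lambda>(xs, ls). distinct xs \<and> map sort_of xs = map sort_of ls)"

definition bisim_cong :: "('s \<rightharpoonup> 's list) \<Rightarrow> 's agent \<Rightarrow> 's agent \<Rightarrow> bool" where
  "bisim_cong ob P Q \<longleftrightarrow>
     (\<forall>\<sigma>s. list_all valid_subst \<sigma>s \<longrightarrow>
        bisimilar ob (fold (\<lambda>(xs, ls). subst_agent (name_subst xs ls)) \<sigma>s P)
                     (fold (\<lambda>(xs, ls). subst_agent (name_subst xs ls)) \<sigma>s Q))"

subsection \<open>Structural congruence\<close>

inductive scong :: "'s agent \<Rightarrow> 's agent \<Rightarrow> bool" where
  Refl: "scong P P"
| Sym: "scong P Q \<Longrightarrow> scong Q P"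
| Trans: "\<lbrakk>scong P Q; scong Q R\<rbrakk> \<Longrightarrow> scong P R"
| Output: "scong P Q \<Longrightarrow> scong (Output M N P) (Output M N Q)"
| Input: "scong P Q \<Longrightarrow> scong (Input M xs X P) (Input M xs X Q)"
| Case: "list_all2 (rel_prod (=) scong) Cs Ds \<Longrightarrow> scong (Case Cs) (Case Ds)"
| Res: "scong P Q \<Longrightarrow> scong (Res a P) (Res a Q)"
| Par: "\<lbrakk>scong P P'; scong Q Q'\<rbrakk> \<Longrightarrow> scong (Par P Q) (Par P' Q')"
| Rep: "scong P Q \<Longrightarrow> scong (Rep P) (Rep Q)"
| Case_Res: "(\<forall>c\<in>set Cs. a \<notin> set_cond (fst c)) \<Longrightarrow>
    scong (Case (map (\<lambda>(\<phi>, P). (\<phi>, Res a P)) Cs)) (Res a (Case Cs))"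
| Input_Res: "a \<notin> set_tm M \<union> set xs \<union> set_pat X \<Longrightarrow>
    scong (Input M xs X (Res a P)) (Res a (Input M xs X P))"
| Output_Res: "a \<notin> set_tm M \<union> set_tm N \<Longrightarrow> scong (Output M N (Res a P)) (Res a (Output M N P))"
| Par_Res: "a \<notin> fn Q \<Longrightarrow> scong (Par Q (Res a P)) (Res a (Par Q P))"
| Res_comm: "scong (Res b (Res a P)) (Res a (Res b P))"
| Rep_unfold: "scong (Rep P) (Par P (Rep P))"
| Par_assoc: "scong (Par P (Par Q R)) (Par (Par P Q) R)"
| Par_comm: "scong (Par P Q) (Par Q P)"
| Par_Zero: "scong P (Par P Zero)"
| Res_Zero: "scong (Res a Zero) Zero"
monos list.rel_mono_strong prod.rel_mono_strong

lemma guarded_simps: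
  "guarded (Output M N P)" "guarded (Input M xs X P)" "guarded (Res a P) = guarded P"
  "guarded (Par P Q) = (guarded P \<and> guarded Q)" "guarded (Rep P) = guarded P"
  by (transfer, simp)+

lemma guarded_Case: "guarded (Case Cs) = (\<forall>c\<in>set Cs. guarded (snd c))"
  by transfer simp

lemma wf_agent_simps:
  "wf_agent ob (Output M N P) = (can_carry ob (sort_tm M) (sort_tm N) \<and> wf_agent ob P)"
  "wf_agent ob (Input M xs X P) =
    (can_carry ob (sort_tm M) (sort_pat X) \<and> distinct_pat X \<and>
     distinct xs \<and> set xs = set_pat X \<and> wf_agent ob P)"
  "wf_agent ob (Res a P) = wf_agent ob P"
  "wf_agent ob (Par P Q) = (wf_agent ob P \<and> wf_agent ob Q)"
  "wf_agent ob (Rep P) = (guarded P \<and> wf_agent ob P)"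
  by (transfer, simp)+

lemma wf_agent_Case: "wf_agent ob (Case Cs) = (\<forall>c\<in>set Cs. guarded (snd c) \<and> wf_agent ob (snd c))"
  by transfer simp

text \<open>
  Well-formedness is invariant under \<open>scong\<close>, which thus restricts to the structural congruence
  of well-formed agents.
\<close>

lemma scong_guarded: "scong P Q \<Longrightarrow> guarded P = guarded Q"
proof (induction rule: scong.induct)
  case (Case Cs Ds)
  then show ?case
    unfolding guarded_Case by (induction rule: list_all2_induct) (auto simp: rel_prod_sel)
qed (auto simp: guarded_simps guarded_Case)

lemma scong_wf_agent: "scong P Q \<Longrightarrow> wf_agent ob P = wf_agent ob Q"
proof (induction rule: scong.induct)
  case (Case Cs Ds)
  then show ?case
    unfolding wf_agent_Case
    by (induction rule: list_all2_induct) (auto simp: rel_prod_sel scong_guarded)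
qed (auto simp: guarded_simps guarded_Case wf_agent_simps wf_agent_Case scong_guarded)

subsection \<open>Contexts\<close>

datatype 'n ctx =
    Hole
  | COut "'n tm" "'n tm" "'n ctx"
  | CIn "'n tm" "'n list" "'n pat" "'n ctx"
  | CCase "('n cond \<times> 'n ctx) list"
  | CRes 'n "'n ctx"
  | CPar "'n ctx" "'n ctx"
  | CRep "'n ctx"
  | CAssert assertion

fun holes :: "'n ctx \<Rightarrow> nat" where
  "holes Hole = 1"
| "holes (COut M N C) = holes C"
| "holes (CIn M xs X C) = holes C"
| "holes (CCase Cs) = (\<Sum>c\<leftarrow>Cs. holes (snd c))"
| "holes (CRes a C) = holes C"
| "holes (CPar C D) = holes C + holes D"
| "holes (CRep C) = holes C"
| "holes (CAssert \<Psi>) = 0"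

text \<open>
  The names of a context are not subject to alpha-conversion, so filling captures free names of
  the arguments.
\<close>

fun fill :: "'s name ctx \<Rightarrow> 's agent list \<Rightarrow> 's agent"
  and fill_branches :: "('s name cond \<times> 's name ctx) list \<Rightarrow> 's agent list \<Rightarrow> ('s name cond \<times> 's agent) list"
where
  "fill Hole Ps = hd Ps"
| "fill (COut M N C) Ps = Output M N (fill C Ps)"
| "fill (CIn M xs X C) Ps = Input M xs X (fill C Ps)"
| "fill (CCase Cs) Ps = Case (fill_branches Cs Ps)"
| "fill (CRes a C) Ps = Res a (fill C Ps)"
| "fill (CPar C D) Ps = Par (fill C (take (holes C) Ps)) (fill D (drop (holes C) Ps))"
| "fill (CRep C) Ps = Rep (fill C Ps)"
| "fill (CAssert \<Psi>) Ps = Assert \<Psi>"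
| "fill_branches [] Ps = []"
| "fill_branches ((\<phi>, C) # Cs) Ps =
    (\<phi>, fill C (take (holes C) Ps)) # fill_branches Cs (drop (holes C) Ps)"

section \<open>Representations of process calculi in SORTEDPPI\<close>

text \<open>
  A process calculus with name-dependent process constructors: an element of \<open>'f\<close> is a
  constructor together with its name parameters, and \<open>build f Ps\<close> applies it to \<open>arity f\<close>
  processes. The result need not be a process of the calculus. All swap operations have to be
  trivial for names of different sorts.
\<close>

record ('s, 'p, 'l, 'f) calculus =
  procs :: "'p set"
  swap_proc :: "'s name \<Rightarrow> 's name \<Rightarrow> 'p \<Rightarrow> 'p"
  swap_label :: "'s name \<Rightarrow> 's name \<Rightarrow> 'l \<Rightarrow> 'l"
  swap_con :: "'s name \<Rightarrow> 's name \<Rightarrow> 'f \<Rightarrow> 'f"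
  arity :: "'f \<Rightarrow> nat"
  build :: "'f \<Rightarrow> 'p list \<Rightarrow> 'p"
  step :: "'p \<Rightarrow> 'l \<Rightarrow> 'p \<Rightarrow> bool"

definition representation ::
  "('s \<rightharpoonup> 's list) \<Rightarrow> ('s, 'p, 'l, 'f) calculus \<Rightarrow> ('p \<Rightarrow> 's agent) \<Rightarrow>
   ('l \<Rightarrow> 's name action \<Rightarrow> bool) \<Rightarrow> bool"
where
  "representation ob K enc rel \<longleftrightarrow>
     (\<forall>P\<in>procs K. wf_agent ob (enc P)) \<and>
     (\<forall>a b. \<forall>P\<in>procs K. enc (swap_proc K a b P) = swap_agent a b (enc P)) \<and>
     (\<forall>a b \<beta> \<alpha>. rel \<beta> \<alpha> \<longrightarrow> rel (swap_label K a b \<beta>) (map_action (swp a b) \<alpha>)) \<and>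
     (\<exists>C. (\<forall>a b f. C (swap_con K a b f) = map_ctx (swp a b) (C f)) \<and>
          (\<forall>f. holes (C f) = arity K f) \<and>
          (\<forall>f Ps. length Ps = arity K f \<longrightarrow> set Ps \<subseteq> procs K \<longrightarrow> build K f Ps \<in> procs K \<longrightarrow>
             enc (build K f Ps) = fill (C f) (map enc Ps))) \<and>
     (\<forall>P\<in>procs K. \<forall>\<beta> P'. step K P \<beta> P' \<longrightarrow>
        (\<exists>\<alpha> Q. psi_trans (enc P) \<alpha> Q \<and> scong (enc P') Q \<and> rel \<beta> \<alpha>)) \<and>
     (\<forall>P\<in>procs K. \<forall>\<alpha> Q. psi_trans (enc P) \<alpha> Q \<longrightarrow>
        (\<exists>\<beta>. \<exists>P'\<in>procs K. step K P \<beta> P' \<and> scong (enc P') Q \<and> rel \<beta> \<alpha>))"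

definition is_representation :: "('s \<rightharpoonup> 's list) \<Rightarrow> ('s, 'p, 'l, 'f) calculus \<Rightarrow> bool" where
  "is_representation ob K \<longleftrightarrow> (\<exists>enc rel. representation ob K enc rel)"

definition is_complete_representation :: "('s \<rightharpoonup> 's list) \<Rightarrow> ('s, 'p, 'l, 'f) calculus \<Rightarrow> bool" where
  "is_complete_representation ob K \<longleftrightarrow>
     (\<exists>enc rel. representation ob K enc rel \<and>
        (\<forall>P. wf_agent ob P \<longrightarrow> (\<exists>Q\<in>procs K. bisim_cong ob P (enc Q))))"

section \<open>The sorted polyadic pi-calculus\<close>

subsection \<open>Raw processes and alpha-equivalence\<close>

datatype 'n rproc =
    RPNil
  | RPIn 'n "'n list" "'n rproc"
  | RPOut 'n "'n list" "'n rproc"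
  | RPMatch 'n 'n "'n rproc"
  | RPRes 'n "'n rproc"
  | RPRep "'n rproc"
  | RPPar "'n rproc" "'n rproc"
  | RPSum "'n rproc" "'n rproc"

fun rpfn :: "'n rproc \<Rightarrow> 'n set" where
  "rpfn RPNil = {}"
| "rpfn (RPIn x ys P) = {x} \<union> (rpfn P - set ys)"
| "rpfn (RPOut x ys P) = {x} \<union> set ys \<union> rpfn P"
| "rpfn (RPMatch a b P) = {a, b} \<union> rpfn P"
| "rpfn (RPRes x P) = rpfn P - {x}"
| "rpfn (RPRep P) = rpfn P"
| "rpfn (RPPar P Q) = rpfn P \<union> rpfn Q"
| "rpfn (RPSum P Q) = rpfn P \<union> rpfn Q"

inductive rpalpha :: "'s name rproc \<Rightarrow> 's name rproc \<Rightarrow> bool" where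
  Nil: "rpalpha RPNil RPNil"
| In: "\<lbrakk>sperm p; \<And>a. a \<in> rpfn P - set ys \<Longrightarrow> p a = a; rpalpha (map_rproc p P) Q\<rbrakk> \<Longrightarrow>
    rpalpha (RPIn x ys P) (RPIn x (map p ys) Q)"
| Out: "rpalpha P Q \<Longrightarrow> rpalpha (RPOut x ys P) (RPOut x ys Q)"
| Match: "rpalpha P Q \<Longrightarrow> rpalpha (RPMatch a b P) (RPMatch a b Q)"
| Res: "\<lbrakk>sperm p; \<And>a. a \<in> rpfn P - {x} \<Longrightarrow> p a = a; rpalpha (map_rproc p P) Q\<rbrakk> \<Longrightarrow>
    rpalpha (RPRes x P) (RPRes (p x) Q)"
| Rep: "rpalpha P Q \<Longrightarrow> rpalpha (RPRep P) (RPRep Q)"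
| Par: "\<lbrakk>rpalpha P P'; rpalpha Q Q'\<rbrakk> \<Longrightarrow> rpalpha (RPPar P Q) (RPPar P' Q')"
| Sum: "\<lbrakk>rpalpha P P'; rpalpha Q Q'\<rbrakk> \<Longrightarrow> rpalpha (RPSum P Q) (RPSum P' Q')"

fun rpwf :: "('s \<rightharpoonup> 's list) \<Rightarrow> 's name rproc \<Rightarrow> bool" where
  "rpwf ob RPNil = True"
| "rpwf ob (RPIn x ys P) =
    (distinct ys \<and> ob (sort_of x) = Some (map sort_of ys) \<and> rpwf ob P)"
| "rpwf ob (RPOut x ys P) = (ob (sort_of x) = Some (map sort_of ys) \<and> rpwf ob P)"
| "rpwf ob (RPMatch a b P) = rpwf ob P"
| "rpwf ob (RPRes x P) = rpwf ob P"
| "rpwf ob (RPRep P) = rpwf ob P"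
| "rpwf ob (RPPar P Q) = (rpwf ob P \<and> rpwf ob Q)"
| "rpwf ob (RPSum P Q) = (rpwf ob P \<and> rpwf ob Q)"

fun rpsubst :: "('s name \<Rightarrow> 's name) \<Rightarrow> 's name rproc \<Rightarrow> 's name rproc" where
  "rpsubst \<sigma> RPNil = RPNil"
| "rpsubst \<sigma> (RPIn x ys P) =
    (let r = fresh_renaming (set ys) (\<sigma> ` (rpfn P - set ys));
         \<tau> = override_on \<sigma> r (set ys)
     in RPIn (\<sigma> x) (map \<tau> ys) (rpsubst \<tau> P))"
| "rpsubst \<sigma> (RPOut x ys P) = RPOut (\<sigma> x) (map \<sigma> ys) (rpsubst \<sigma> P)"
| "rpsubst \<sigma> (RPMatch a b P) = RPMatch (\<sigma> a) (\<sigma> b) (rpsubst \<sigma> P)"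
| "rpsubst \<sigma> (RPRes x P) =
    (let r = fresh_renaming {x} (\<sigma> ` (rpfn P - {x}));
         \<tau> = override_on \<sigma> r {x}
     in RPRes (\<tau> x) (rpsubst \<tau> P))"
| "rpsubst \<sigma> (RPRep P) = RPRep (rpsubst \<sigma> P)"
| "rpsubst \<sigma> (RPPar P Q) = RPPar (rpsubst \<sigma> P) (rpsubst \<sigma> Q)"
| "rpsubst \<sigma> (RPSum P Q) = RPSum (rpsubst \<sigma> P) (rpsubst \<sigma> Q)"

lemma finite_rpfn: "finite (rpfn P)"
  by (induction P) auto

lemma rpfn_map: "inj p \<Longrightarrow> rpfn (map_rproc p P) = p ` rpfn P"
  by (induction P) (simp_all add: image_Un image_set_diff)

lemma sperm_fixed_diff:
  assumes "sperm p" "\<And>a. a \<in> F - A \<Longrightarrow> p a = a"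
  shows "p ` F - p ` A = F - A"
proof -
  have "p ` (F - A) = F - A"
    by (rule trans[OF image_cong[OF refl] image_ident]) (rule assms(2))
  then show ?thesis
    by (simp add: image_set_diff[OF sperm_inj[OF assms(1)]])
qed

lemma rpalpha_rpfn: "rpalpha P Q \<Longrightarrow> rpfn P = rpfn Q"
proof (induction rule: rpalpha.induct)
  case (In p P ys Q x)
  have "rpfn Q = p ` rpfn P"
    using In.IH rpfn_map[OF sperm_inj[OF In.hyps(1)], of P] by simp
  then have "rpfn Q - set (map p ys) = p ` (rpfn P - set ys)"
    by (simp add: image_set_diff[OF sperm_inj[OF In.hyps(1)]])
  also have "\<dots> = rpfn P - set ys"
    by (rule trans[OF image_cong[OF refl] image_ident]) (rule In.hyps(2))
  finally show ?case
    by simp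
next
  case (Res p P x Q)
  have "rpfn Q = p ` rpfn P"
    using Res.IH rpfn_map[OF sperm_inj[OF Res.hyps(1)], of P] by simp
  then have "rpfn Q - {p x} = p ` (rpfn P - {x})"
    by (simp add: image_set_diff[OF sperm_inj[OF Res.hyps(1)]])
  also have "\<dots> = rpfn P - {x}"
    by (rule trans[OF image_cong[OF refl] image_ident]) (rule Res.hyps(2))
  finally show ?case
    by simp
qed auto

lemma rpalpha_perm:
  assumes "rpalpha P Q" "sperm k"
  shows "rpalpha (map_rproc k P) (map_rproc k Q)"
  using assms
proof (induction rule: rpalpha.induct)
  case (In p P ys Q x)
  let ?p = "k \<circ> p \<circ> inv k"
  note c = sperm_conj[OF In.prems In.hyps(1)]
  have "?p b = b" if "b \<in> rpfn (map_rproc k P) - set (map k ys)" for b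
  proof -
    have "b \<in> k ` (rpfn P - set ys)"
      using that rpfn_map[OF sperm_inj[OF In.prems], of P] by auto
    then obtain a where a: "b = k a" "a \<in> rpfn P - set ys"
      by blast
    then show ?thesis
      using In.hyps(2)[OF a(2)] c(3) by simp
  qed
  moreover have "rpalpha (map_rproc ?p (map_rproc k P)) (map_rproc k Q)"
    using In.IH In.prems by (simp add: rproc.map_comp c)
  ultimately have "rpalpha (RPIn (k x) (map k ys) (map_rproc k P))
      (RPIn (k x) (map ?p (map k ys)) (map_rproc k Q))"
    using c(1) by (intro rpalpha.In)
  then show ?case
    by (simp only: rproc.map list.map_comp c(2))
next
  case (Res p P x Q)
  let ?p = "k \<circ> p \<circ> inv k"
  note c = sperm_conj[OF Res.prems Res.hyps(1)]
  have "?p b = b" if "b \<in> rpfn (map_rproc k P) - {k x}" for b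
  proof -
    have "b \<in> k ` rpfn P" "b \<noteq> k x"
      using that by (simp_all add: rpfn_map[OF sperm_inj[OF Res.prems]])
    then obtain d where d: "b = k d" "d \<in> rpfn P - {x}"
      by blast
    then show ?thesis
      using Res.hyps(2)[OF d(2)] c(3) by simp
  qed
  moreover have "rpalpha (map_rproc ?p (map_rproc k P)) (map_rproc k Q)"
    using Res.IH Res.prems by (simp add: rproc.map_comp c)
  ultimately have "rpalpha (RPRes (k x) (map_rproc k P)) (RPRes (?p (k x)) (map_rproc k Q))"
    using c(1) by (intro rpalpha.Res)
  then show ?case
    by (simp only: rproc.map c(3))
qed (auto intro: rpalpha.intros)

lemma rpalpha_In_cong: "rpalpha P Q \<Longrightarrow> rpalpha (RPIn x ys P) (RPIn x ys Q)"
  using rpalpha.In[OF sperm_id, of P ys Q x] by (simp add: rproc.map_id)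

lemma rpalpha_In_subject: "rpalpha (RPIn x ys P) (RPIn x' zs Q) \<Longrightarrow> rpalpha (RPIn y ys P) (RPIn y zs Q)"
  by (erule rpalpha.cases) (auto intro: rpalpha.In)

lemma rpalpha_Res_cong: "rpalpha P Q \<Longrightarrow> rpalpha (RPRes x P) (RPRes x Q)"
  using rpalpha.Res[OF sperm_id, of P x Q] by (simp add: rproc.map_id)

lemma rpalpha_refl: "rpalpha P P"
  by (induction P) (auto intro: rpalpha.intros rpalpha_In_cong rpalpha_Res_cong)

lemma rpalpha_sym: "rpalpha P Q \<Longrightarrow> rpalpha Q P"
proof (induction rule: rpalpha.induct)
  case (In p P ys Q x)
  have f: "rpfn Q - set (map p ys) = rpfn P - set ys"
    using rpalpha_rpfn[OF In.hyps(3)] sperm_fixed_diff[OF In.hyps(1), of "rpfn P" "set ys"] In.hyps(2)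
    by (simp add: rpfn_map[OF sperm_inj[OF In.hyps(1)]])
  have "rpalpha (map_rproc (inv p) Q) P"
    using rpalpha_perm[OF In.IH sperm_inv[OF In.hyps(1)]]
    by (simp add: rproc.map_comp sperm_inv_comp[OF In.hyps(1)] rproc.map_id)
  moreover have "inv p b = b" if "b \<in> rpfn Q - set (map p ys)" for b
    using that In.hyps(2)[of b] sperm_inv_apply[OF In.hyps(1), of b] unfolding f by simp
  ultimately have "rpalpha (RPIn x (map p ys) Q) (RPIn x (map (inv p) (map p ys)) P)"
    using sperm_inv[OF In.hyps(1)] by (intro rpalpha.In)
  then show ?case
    by (simp add: sperm_inv_comp[OF In.hyps(1)])
next
  case (Res p P x Q)
  have f: "rpfn Q - {p x} = rpfn P - {x}"
    using rpalpha_rpfn[OF rpalpha.Res[OF Res.hyps(1-3)]] by simp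
  have "rpalpha (map_rproc (inv p) Q) P"
    using rpalpha_perm[OF Res.IH sperm_inv[OF Res.hyps(1)]]
    by (simp add: rproc.map_comp sperm_inv_comp[OF Res.hyps(1)] rproc.map_id)
  moreover have "inv p b = b" if "b \<in> rpfn Q - {p x}" for b
    using that Res.hyps(2)[of b] sperm_inv_apply[OF Res.hyps(1), of b] unfolding f by simp
  ultimately have "rpalpha (RPRes (p x) Q) (RPRes (inv p (p x)) P)"
    using sperm_inv[OF Res.hyps(1)] by (intro rpalpha.Res)
  then show ?case
    by (simp add: sperm_inv_apply[OF Res.hyps(1)])
qed (auto intro: rpalpha.intros)

lemma rpalpha_trans: "rpalpha P Q \<Longrightarrow> rpalpha Q R \<Longrightarrow> rpalpha P R"
proof (induction arbitrary: R rule: rpalpha.induct)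
  case (In p P ys Q x)
  have f: "rpfn Q - set (map p ys) = rpfn P - set ys"
    using rpalpha_rpfn[OF In.hyps(3)] sperm_fixed_diff[OF In.hyps(1), of "rpfn P" "set ys"] In.hyps(2)
    by (simp add: rpfn_map[OF sperm_inj[OF In.hyps(1)]])
  from In.prems obtain q R' where q: "sperm q"
    "\<And>a. a \<in> rpfn Q - set (map p ys) \<Longrightarrow> q a = a" "rpalpha (map_rproc q Q) R'"
    and R: "R = RPIn x (map q (map p ys)) R'"
    by (cases rule: rpalpha.cases) auto
  have "rpalpha Q (map_rproc (inv q) R')"
    using rpalpha_perm[OF q(3) sperm_inv[OF q(1)]]
    by (simp add: rproc.map_comp sperm_inv_comp[OF q(1)] rproc.map_id)
  then have "rpalpha (map_rproc p P) (map_rproc (inv q) R')"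
    by (rule In.IH)
  then have "rpalpha (map_rproc q (map_rproc p P)) (map_rproc q (map_rproc (inv q) R'))"
    using q(1) by (rule rpalpha_perm)
  then have "rpalpha (map_rproc (q \<circ> p) P) R'"
    by (simp add: rproc.map_comp sperm_comp_inv[OF q(1)] rproc.map_id)
  moreover have "(q \<circ> p) a = a" if "a \<in> rpfn P - set ys" for a
    using that In.hyps(2)[of a] q(2)[of a] unfolding f by simp
  ultimately have "rpalpha (RPIn x ys P) (RPIn x (map (q \<circ> p) ys) R')"
    using sperm_comp[OF q(1) In.hyps(1)] by (intro rpalpha.In)
  then show ?case
    by (simp add: R)
next
  case (Res p P x Q)
  have f: "rpfn Q - {p x} = rpfn P - {x}"
    using rpalpha_rpfn[OF rpalpha.Res[OF Res.hyps(1-3)]] by simp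
  from Res.prems obtain q R' where q: "sperm q"
    "\<And>b. b \<in> rpfn Q - {p x} \<Longrightarrow> q b = b" "rpalpha (map_rproc q Q) R'"
    and R: "R = RPRes (q (p x)) R'"
    by (cases rule: rpalpha.cases) auto
  have "rpalpha Q (map_rproc (inv q) R')"
    using rpalpha_perm[OF q(3) sperm_inv[OF q(1)]]
    by (simp add: rproc.map_comp sperm_inv_comp[OF q(1)] rproc.map_id)
  then have "rpalpha (map_rproc p P) (map_rproc (inv q) R')"
    by (rule Res.IH)
  then have "rpalpha (map_rproc q (map_rproc p P)) (map_rproc q (map_rproc (inv q) R'))"
    using q(1) by (rule rpalpha_perm)
  then have "rpalpha (map_rproc (q \<circ> p) P) R'"
    by (simp add: rproc.map_comp sperm_comp_inv[OF q(1)] rproc.map_id)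
  moreover have "(q \<circ> p) b = b" if "b \<in> rpfn P - {x}" for b
    using that Res.hyps(2)[of b] q(2)[of b] unfolding f by simp
  ultimately have "rpalpha (RPRes x P) (RPRes ((q \<circ> p) x) R')"
    using sperm_comp[OF q(1) Res.hyps(1)] by (intro rpalpha.Res)
  then show ?case
    by (simp add: R)
next
  case (Out P Q x ys)
  from Out.prems show ?case
    by (cases rule: rpalpha.cases) (auto intro: rpalpha.Out Out.IH)
next
  case (Match P Q a b)
  from Match.prems show ?case
    by (cases rule: rpalpha.cases) (auto intro: rpalpha.Match Match.IH)
next
  case (Par P P' Q Q')
  from Par.prems show ?case
    by (cases rule: rpalpha.cases) (auto intro: rpalpha.Par Par.IH)
next
  case (Sum P P' Q Q')
  from Sum.prems show ?case
    by (cases rule: rpalpha.cases) (auto intro: rpalpha.Sum Sum.IH)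
next
  case (Rep P Q)
  from Rep.prems show ?case
    by (cases rule: rpalpha.cases) (auto intro: rpalpha.Rep Rep.IH)
qed

lemma rpwf_map: "sperm p \<Longrightarrow> rpwf ob (map_rproc p P) = rpwf ob P"
  by (induction P) (auto simp: distinct_map inj_on_subset[OF sperm_inj] sort_of_sperm comp_def)

lemma rpalpha_rpwf: "rpalpha P Q \<Longrightarrow> rpwf ob P = rpwf ob Q"
  by (induction rule: rpalpha.induct)
    (auto simp: rpwf_map distinct_map inj_on_subset[OF sperm_inj] sort_of_sperm comp_def)

lemma rpfn_rpsubst: "rpfn (rpsubst \<sigma> P) = \<sigma> ` rpfn P"
proof (induction P arbitrary: \<sigma>)
  case (RPIn x ys P)
  define \<tau> where "\<tau> = override_on \<sigma> (fresh_renaming (set ys) (\<sigma> ` (rpfn P - set ys))) (set ys)"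
  have "\<tau> ` rpfn P - \<tau> ` set ys = \<sigma> ` (rpfn P - set ys)"
    using \<tau>_def by (intro override_image_diff) (simp_all add: finite_rpfn)
  then show ?case
    using RPIn by (simp add: Let_def \<tau>_def[symmetric])
next
  case (RPRes x P)
  define \<tau> where "\<tau> = override_on \<sigma> (fresh_renaming {x} (\<sigma> ` (rpfn P - {x}))) {x}"
  have "\<tau> ` rpfn P - \<tau> ` {x} = \<sigma> ` (rpfn P - {x})"
    using \<tau>_def by (intro override_image_diff) (simp_all add: finite_rpfn)
  moreover have "rpsubst \<sigma> (RPRes x P) = RPRes (\<tau> x) (rpsubst \<tau> P)"
    by (simp only: rpsubst.simps Let_def \<tau>_def)
  ultimately show ?case
    by (simp add: RPRes.IH del: rpsubst.simps)
qed (simp_all add: image_Un)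

lemma rpsubst_perm:
  assumes "sperm k" "sperm p" "\<And>a. a \<in> rpfn P \<Longrightarrow> k (\<sigma> a) = \<tau> (p a)"
  shows "rpalpha (map_rproc k (rpsubst \<sigma> P)) (rpsubst \<tau> (map_rproc p P))"
  using assms
proof (induction P arbitrary: \<sigma> \<tau> k p)
  case (RPIn x ys P)
  let ?A = "set ys"
  define \<sigma>' where "\<sigma>' = override_on \<sigma> (fresh_renaming ?A (\<sigma> ` (rpfn P - ?A))) ?A"
  define \<tau>' where "\<tau>' = override_on \<tau> (fresh_renaming (p ` ?A) (\<tau> ` (p ` rpfn P - p ` ?A))) (p ` ?A)"
  have "\<exists>h. sperm h \<and> (\<forall>x\<in>rpfn P \<union> ?A. h (k (\<sigma>' x)) = \<tau>' (p x)) \<and>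
      (\<forall>b\<in>k ` \<sigma>' ` rpfn P - k ` \<sigma>' ` ?A. h b = b)"
    by (rule binder_match[OF _ _ RPIn.prems(1,2) _ \<sigma>'_def \<tau>'_def])
      (use RPIn.prems(3) in \<open>auto simp: finite_rpfn\<close>)
  then obtain h where h: "sperm h" "\<And>x. x \<in> rpfn P \<union> ?A \<Longrightarrow> h (k (\<sigma>' x)) = \<tau>' (p x)"
    "\<And>b. b \<in> k ` \<sigma>' ` rpfn P - k ` \<sigma>' ` ?A \<Longrightarrow> h b = b"
    by (elim exE conjE) (rule that, assumption, (erule (1) bspec)+)
  have "rpalpha (map_rproc (h \<circ> k) (rpsubst \<sigma>' P)) (rpsubst \<tau>' (map_rproc p P))"
    using h(2) by (intro RPIn.IH sperm_comp h(1) RPIn.prems) simp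
  then have "rpalpha (map_rproc h (map_rproc k (rpsubst \<sigma>' P))) (rpsubst \<tau>' (map_rproc p P))"
    by (simp add: rproc.map_comp)
  moreover have "h b = b" if "b \<in> rpfn (map_rproc k (rpsubst \<sigma>' P)) - set (map k (map \<sigma>' ys))" for b
    by (rule h(3)) (use that in \<open>simp add: rpfn_map[OF sperm_inj[OF RPIn.prems(1)]] rpfn_rpsubst
        image_image\<close>)
  ultimately have "rpalpha (RPIn (k (\<sigma> x)) (map k (map \<sigma>' ys)) (map_rproc k (rpsubst \<sigma>' P)))
      (RPIn (k (\<sigma> x)) (map h (map k (map \<sigma>' ys))) (rpsubst \<tau>' (map_rproc p P)))"
    using h(1) by (intro rpalpha.In)
  moreover have "map h (map k (map \<sigma>' ys)) = map \<tau>' (map p ys)"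
    using h(2) by simp
  moreover have "rpsubst \<tau> (map_rproc p (RPIn x ys P)) =
      RPIn (\<tau> (p x)) (map \<tau>' (map p ys)) (rpsubst \<tau>' (map_rproc p P))"
    by (simp add: Let_def \<tau>'_def rpfn_map[OF sperm_inj[OF RPIn.prems(2)]])
  moreover have "rpsubst \<sigma> (RPIn x ys P) = RPIn (\<sigma> x) (map \<sigma>' ys) (rpsubst \<sigma>' P)"
    by (simp only: rpsubst.simps Let_def \<sigma>'_def)
  moreover have "k (\<sigma> x) = \<tau> (p x)"
    using RPIn.prems(3) by simp
  ultimately show ?case
    by (simp only: rproc.map)
next
  case (RPRes x P)
  define \<sigma>' where "\<sigma>' = override_on \<sigma> (fresh_renaming {x} (\<sigma> ` (rpfn P - {x}))) {x}"
  define \<tau>' where "\<tau>' = override_on \<tau> (fresh_renaming (p ` {x}) (\<tau> ` (p ` rpfn P - p ` {x}))) (p ` {x})"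
  have "\<exists>h. sperm h \<and> (\<forall>a\<in>rpfn P \<union> {x}. h (k (\<sigma>' a)) = \<tau>' (p a)) \<and>
      (\<forall>b\<in>k ` \<sigma>' ` rpfn P - k ` \<sigma>' ` {x}. h b = b)"
    by (rule binder_match[OF _ _ RPRes.prems(1,2) _ \<sigma>'_def \<tau>'_def])
      (use RPRes.prems(3) in \<open>auto simp: finite_rpfn\<close>)
  then obtain h where h: "sperm h" "\<And>a. a \<in> rpfn P \<union> {x} \<Longrightarrow> h (k (\<sigma>' a)) = \<tau>' (p a)"
    "\<And>b. b \<in> k ` \<sigma>' ` rpfn P - k ` \<sigma>' ` {x} \<Longrightarrow> h b = b"
    by (elim exE conjE) (rule that, assumption, (erule (1) bspec)+)
  have "rpalpha (map_rproc (h \<circ> k) (rpsubst \<sigma>' P)) (rpsubst \<tau>' (map_rproc p P))"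
    using h(2) by (intro RPRes.IH sperm_comp h(1) RPRes.prems) simp
  then have "rpalpha (map_rproc h (map_rproc k (rpsubst \<sigma>' P))) (rpsubst \<tau>' (map_rproc p P))"
    by (simp add: rproc.map_comp)
  moreover have "h b = b" if "b \<in> rpfn (map_rproc k (rpsubst \<sigma>' P)) - {k (\<sigma>' x)}" for b
    by (rule h(3)) (use that in \<open>simp add: rpfn_map[OF sperm_inj[OF RPRes.prems(1)]] rpfn_rpsubst\<close>)
  ultimately have "rpalpha (RPRes (k (\<sigma>' x)) (map_rproc k (rpsubst \<sigma>' P)))
      (RPRes (h (k (\<sigma>' x))) (rpsubst \<tau>' (map_rproc p P)))"
    using h(1) by (intro rpalpha.Res)
  moreover have "rpsubst \<tau> (map_rproc p (RPRes x P)) = RPRes (\<tau>' (p x)) (rpsubst \<tau>' (map_rproc p P))"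
    by (simp only: rproc.map rpsubst.simps Let_def \<tau>'_def rpfn_map[OF sperm_inj[OF RPRes.prems(2)]]
        image_insert image_empty)
  moreover have "rpsubst \<sigma> (RPRes x P) = RPRes (\<sigma>' x) (rpsubst \<sigma>' P)"
    by (simp only: rpsubst.simps Let_def \<sigma>'_def)
  ultimately show ?case
    using h(2)[of x] by (simp del: rpsubst.simps)
next
  case (RPOut x ys P)
  have "map k (map \<sigma> ys) = map \<tau> (map p ys)" "k (\<sigma> x) = \<tau> (p x)"
    using RPOut.prems(3) by simp_all
  moreover have "rpalpha (map_rproc k (rpsubst \<sigma> P)) (rpsubst \<tau> (map_rproc p P))"
    using RPOut.prems by (intro RPOut.IH) simp_all
  ultimately show ?case
    by (simp only: rproc.map rpsubst.simps rpalpha.Out)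
qed (auto intro: rpalpha.intros)

lemma rpalpha_rpsubst: "rpalpha P Q \<Longrightarrow> rpalpha (rpsubst \<sigma> P) (rpsubst \<sigma> Q)"
proof (induction arbitrary: \<sigma> rule: rpalpha.induct)
  case (In p P ys Q x)
  text \<open>Replace the subject by a name that \<open>p\<close> fixes.\<close>
  have "finite {a. p a \<noteq> a}"
    using In.hyps(1) by (simp add: sperm_def)
  moreover have "infinite (range (Name (sort_of x)))"
    by (simp add: finite_image_iff inj_on_def)
  ultimately obtain z where z: "p z = z"
    by (metis (mono_tags, lifting) finite_subset mem_Collect_eq subsetI)
  have "\<sigma> a = \<sigma> (p a)" if "a \<in> rpfn (RPIn z ys P)" for a
    using In.hyps(2)[of a] that z by auto
  then have "rpalpha (rpsubst \<sigma> (RPIn z ys P)) (rpsubst \<sigma> (map_rproc p (RPIn z ys P)))"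
    using rpsubst_perm[OF sperm_id In.hyps(1), of "RPIn z ys P" \<sigma> \<sigma>] by (simp add: rproc.map_id)
  then have "rpalpha (rpsubst \<sigma> (RPIn x ys P)) (rpsubst \<sigma> (RPIn x (map p ys) (map_rproc p P)))"
    by (simp only: rpsubst.simps Let_def rproc.map) (rule rpalpha_In_subject)
  moreover have "rpalpha (rpsubst \<sigma> (RPIn x (map p ys) (map_rproc p P))) (rpsubst \<sigma> (RPIn x (map p ys) Q))"
    using In.IH rpalpha_rpfn[OF In.hyps(3)] by (simp add: Let_def rpalpha_In_cong)
  ultimately show ?case
    by (rule rpalpha_trans)
next
  case (Res p P x Q)
  have "\<sigma> b = \<sigma> (p b)" if "b \<in> rpfn P - {x}" for b
    using Res.hyps(2)[OF that] by simp
  then have "rpalpha (rpsubst \<sigma> (RPRes x P)) (rpsubst \<sigma> (RPRes (p x) (map_rproc p P)))"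
    using rpsubst_perm[OF sperm_id Res.hyps(1), of "RPRes x P" \<sigma> \<sigma>] by (simp add: rproc.map_id)
  moreover have "rpalpha (rpsubst \<sigma> (RPRes (p x) (map_rproc p P))) (rpsubst \<sigma> (RPRes (p x) Q))"
    using Res.IH rpalpha_rpfn[OF Res.hyps(3)] by (simp add: Let_def rpalpha_Res_cong)
  ultimately show ?case
    by (rule rpalpha_trans)
qed (auto intro: rpalpha.intros)


subsection \<open>Processes\<close>

quotient_type 's proc = "'s name rproc" / rpalpha
  by (auto intro!: equivpI reflpI sympI transpI intro: rpalpha_refl rpalpha_sym rpalpha_trans)

lift_definition PNil :: "'s proc" is RPNil .

lift_definition PIn :: "'s name \<Rightarrow> 's name list \<Rightarrow> 's proc \<Rightarrow> 's proc" is RPIn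
  by (rule rpalpha_In_cong)

lift_definition POut :: "'s name \<Rightarrow> 's name list \<Rightarrow> 's proc \<Rightarrow> 's proc" is RPOut
  by (rule rpalpha.Out)

lift_definition PMatch :: "'s name \<Rightarrow> 's name \<Rightarrow> 's proc \<Rightarrow> 's proc" is RPMatch
  by (rule rpalpha.Match)

lift_definition PRes :: "'s name \<Rightarrow> 's proc \<Rightarrow> 's proc" is RPRes
  by (rule rpalpha_Res_cong)

lift_definition PRep :: "'s proc \<Rightarrow> 's proc" is RPRep
  by (rule rpalpha.Rep)

lift_definition PPar :: "'s proc \<Rightarrow> 's proc \<Rightarrow> 's proc" is RPPar
  by (rule rpalpha.Par)

lift_definition PSum :: "'s proc \<Rightarrow> 's proc \<Rightarrow> 's proc" is RPSum
  by (rule rpalpha.Sum)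

lift_definition pfn :: "'s proc \<Rightarrow> 's name set" is rpfn
  by (rule rpalpha_rpfn)

lift_definition well_sorted :: "('s \<rightharpoonup> 's list) \<Rightarrow> 's proc \<Rightarrow> bool" is rpwf
  by (rule rpalpha_rpwf)

lift_definition swap_pi :: "'s name \<Rightarrow> 's name \<Rightarrow> 's proc \<Rightarrow> 's proc" is
  "\<lambda>a b. map_rproc (swp a b)"
  by (rule rpalpha_perm[OF _ sperm_swp])

lift_definition subst_pi :: "('s name \<Rightarrow> 's name) \<Rightarrow> 's proc \<Rightarrow> 's proc" is rpsubst
  by (rule rpalpha_rpsubst)

subsection \<open>Transitions\<close>

text \<open>The bound names of an output action form a set, as their order is immaterial.\<close>

datatype 'n paction = POutA "'n set" 'n "'n list" | PInA 'n "'n list" | PTau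

fun pbn :: "'n paction \<Rightarrow> 'n set" where
  "pbn (POutA Y z ys) = Y"
| "pbn _ = {}"

fun pnames :: "'n paction \<Rightarrow> 'n set" where
  "pnames (POutA Y z ys) = Y \<union> {z} \<union> set ys"
| "pnames (PInA x zs) = {x} \<union> set zs"
| "pnames PTau = {}"

fun swap_paction :: "'s name \<Rightarrow> 's name \<Rightarrow> 's name paction \<Rightarrow> 's name paction" where
  "swap_paction a b (POutA Y z ys) = POutA (swp a b ` Y) (swp a b z) (map (swp a b) ys)"
| "swap_paction a b (PInA x zs) = PInA (swp a b x) (map (swp a b) zs)"
| "swap_paction a b PTau = PTau"

text \<open>
  As for psi-calculi, \<open>Alpha\<close> renames the bound names of an output action together with the
  derivative.
\<close>

inductive pi_trans :: "'s proc \<Rightarrow> 's name paction \<Rightarrow> 's proc \<Rightarrow> bool" where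
  Out: "pi_trans (POut x ys P) (POutA {} x ys) P"
| In: "map sort_of zs = map sort_of ys \<Longrightarrow>
    pi_trans (PIn x ys P) (PInA x zs) (subst_pi (name_subst ys zs) P)"
| SumL: "pi_trans P \<beta> P' \<Longrightarrow> pi_trans (PSum P Q) \<beta> P'"
| SumR: "pi_trans Q \<beta> Q' \<Longrightarrow> pi_trans (PSum P Q) \<beta> Q'"
| Match: "pi_trans P \<beta> P' \<Longrightarrow> pi_trans (PMatch x x P) \<beta> P'"
| ParL: "\<lbrakk>pi_trans P \<beta> P'; pbn \<beta> \<inter> pfn Q = {}\<rbrakk> \<Longrightarrow> pi_trans (PPar P Q) \<beta> (PPar P' Q)"
| ParR: "\<lbrakk>pi_trans Q \<beta> Q'; pbn \<beta> \<inter> pfn P = {}\<rbrakk> \<Longrightarrow> pi_trans (PPar P Q) \<beta> (PPar P Q')"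
| Res: "\<lbrakk>pi_trans P \<beta> P'; x \<notin> pnames \<beta>\<rbrakk> \<Longrightarrow> pi_trans (PRes x P) \<beta> (PRes x P')"
| Rep: "pi_trans (PPar P (PRep P)) \<beta> P' \<Longrightarrow> pi_trans (PRep P) \<beta> P'"
| ComL: "\<lbrakk>pi_trans P (POutA Y x ys) P'; pi_trans Q (PInA x ys) Q'; Y \<inter> pfn Q = {};
     distinct bs; set bs = Y\<rbrakk> \<Longrightarrow>
    pi_trans (PPar P Q) PTau (foldr PRes bs (PPar P' Q'))"
| ComR: "\<lbrakk>pi_trans P (PInA x ys) P'; pi_trans Q (POutA Y x ys) Q'; Y \<inter> pfn P = {};
     distinct bs; set bs = Y\<rbrakk> \<Longrightarrow>
    pi_trans (PPar P Q) PTau (foldr PRes bs (PPar P' Q'))"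
| Open: "\<lbrakk>pi_trans P (POutA Y z ys) P'; x \<noteq> z; x \<in> set ys - Y\<rbrakk> \<Longrightarrow>
    pi_trans (PRes x P) (POutA (insert x Y) z ys) P'"
| Alpha: "\<lbrakk>pi_trans P (POutA Y z ys) P'; c \<in> Y; sort_of d = sort_of c;
     d \<notin> {z} \<union> set ys \<union> pfn P'\<rbrakk> \<Longrightarrow>
    pi_trans P (POutA (swp c d ` Y) z (map (swp c d) ys)) (swap_pi c d P')"

subsection \<open>The calculus\<close>

datatype 'n pcon =
  KNil | KIn 'n "'n list" | KOut 'n "'n list" | KMatch 'n 'n | KRes 'n | KRep | KPar | KSum

fun pcon_arity :: "'n pcon \<Rightarrow> nat" where
  "pcon_arity KNil = 0"
| "pcon_arity KPar = 2"
| "pcon_arity KSum = 2"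
| "pcon_arity _ = 1"

fun pcon_build :: "'s name pcon \<Rightarrow> 's proc list \<Rightarrow> 's proc" where
  "pcon_build KNil Ps = PNil"
| "pcon_build (KIn x ys) Ps = PIn x ys (Ps ! 0)"
| "pcon_build (KOut x ys) Ps = POut x ys (Ps ! 0)"
| "pcon_build (KMatch a b) Ps = PMatch a b (Ps ! 0)"
| "pcon_build (KRes x) Ps = PRes x (Ps ! 0)"
| "pcon_build KRep Ps = PRep (Ps ! 0)"
| "pcon_build KPar Ps = PPar (Ps ! 0) (Ps ! 1)"
| "pcon_build KSum Ps = PSum (Ps ! 0) (Ps ! 1)"

definition sorted_polyadic_pi ::
  "('s \<rightharpoonup> 's list) \<Rightarrow> ('s, 's proc, 's name paction, 's name pcon) calculus"
where
  "sorted_polyadic_pi ob =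
     \<lparr>procs = {P. well_sorted ob P},
      swap_proc = swap_pi,
      swap_label = swap_paction,
      swap_con = (\<lambda>a b. map_pcon (swp a b)),
      arity = pcon_arity,
      build = pcon_build,
      step = pi_trans\<rparr>"

end

theory Submission
  imports Defs
begin

text \<open>
  Encode \<open>[a = b]P\<close> as a case with the single condition \<open>a = b\<close>, \<open>P + Q\<close> as a case with two
  conditions \<open>\<top>\<close>, and every other constructor by its counterpart. The names of a pattern are all
  bound, so matching against it amounts to the substitution of the pi-calculus, and the two
  calculi have the same transitions up to the order in which the bound names of an output are
  listed; rule \<open>Open\<close> of the psi-calculus produces every such order. For completeness, drop the
  assertions, turn a case into a sum over its branches, replacing those guarded by \<open>\<bottom>\<close> by inert
  processes, and normalise the order of the names bound by an input. This translation commutes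
  with substitution and preserves and reflects transitions.
\<close>

section \<open>Agents up to alpha-equivalence\<close>

text \<open>Even along the identity, \<open>rsubst\<close> renames every bound name, so literal
  equality fails. The renaming is injective and avoids the free names, hence it extends to a
  permutation of the kind that alpha-equivalence allows.\<close>

lemma rsubst_id: "ralpha (rsubst id P) P"
proof (induction P)
  case (RIn M xs X P)
  let ?S = "set_pat X \<union> rfn P" and ?A = "set xs"
  define r where "r = fresh_renaming ?A (?S - ?A)"
  define \<tau> where "\<tau> = override_on id r ?A"
  have r: "inj_on r ?A" "\<And>a. a \<in> ?A \<Longrightarrow> sort_of (r a) = sort_of a" "r ` ?A \<inter> (?S - ?A) = {}"
    unfolding r_def by (intro fresh_renaming; simp add: finite_rfn finite_set_tm)+
  \<comment> \<open>\<open>k\<close> moves only bound names and their fresh images, so it fixes all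
    names that stay free.\<close>
  obtain k where k: "sperm k" "\<And>a. a \<in> ?A \<Longrightarrow> k a = r a" "\<And>a. a \<notin> ?A \<union> r ` ?A \<Longrightarrow> k a = a"
    using sperm_extend[of ?A r] r by blast
  have fixed: "k b = b" if "b \<in> ?S - ?A" for b
    using that r(3) k(3) by blast
  have eq: "k a = \<tau> a" if "a \<in> ?S \<union> ?A" for a
    using that k(2) fixed[of a] by (cases "a \<in> ?A") (auto simp: \<tau>_def)
  \<comment> \<open>\<open>rsubst_perm\<close> absorbs the permutation into the substitution \<tau>;
    the induction hypothesis then removes \<open>rsubst id\<close> under \<open>k\<close>.\<close>
  have "ralpha (map_ragent k (rsubst id P)) (rsubst \<tau> P)"
    using rsubst_perm[OF k(1) sperm_id, of P id \<tau>] eq by (simp add: ragent.map_id)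
  then have "ralpha (map_ragent k P) (rsubst \<tau> P)"
    using RIn.IH k(1) by (blast intro: ralpha_trans ralpha_sym ralpha_perm)
  then have "ralpha (RIn M xs X P) (RIn M (map k xs) (map_pat k X) (rsubst \<tau> P))"
    using k(1) fixed by (intro ralpha.In)
  moreover have "map k xs = map \<tau> xs" "map_pat k X = map_pat \<tau> X"
    using eq by (auto intro!: pat.map_cong0)
  moreover have "rsubst id (RIn M xs X P) = RIn M (map \<tau> xs) (map_pat \<tau> X) (rsubst \<tau> P)"
    by (simp only: rsubst.simps Let_def image_id id_apply tm.map_id \<tau>_def r_def)
  ultimately show ?case
    by (metis ralpha_sym)
next
  case (RRes a P)
  define c where "c = fresh_renaming {a} (rfn P - {a}) a"
  define \<tau> where "\<tau> = override_on id (fresh_renaming {a} (rfn P - {a})) {a}"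
  have c: "sort_of c = sort_of a" "c \<notin> rfn P - {a}"
    using fresh_renaming[of "{a}" "rfn P - {a}"] by (auto simp: finite_rfn c_def)
  let ?k = "swp a c"
  have k: "?k a = c" "\<And>b. b \<in> rfn P - {a} \<Longrightarrow> ?k b = b"
    using c by (auto simp: swp_def transpose_def)
  have "?k b = \<tau> b" if "b \<in> rfn P" for b
    using that k by (cases "b = a") (auto simp: \<tau>_def c_def)
  then have "ralpha (map_ragent ?k (rsubst id P)) (rsubst \<tau> P)"
    using rsubst_perm[OF sperm_swp sperm_id, of P a c id \<tau>] by (simp add: ragent.map_id)
  then have "ralpha (map_ragent ?k P) (rsubst \<tau> P)"
    using RRes.IH sperm_swp by (blast intro: ralpha_trans ralpha_sym ralpha_perm)
  then have "ralpha (RRes a P) (RRes (?k a) (rsubst \<tau> P))"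
    using k(2) by (intro ralpha.Res sperm_swp)
  moreover have "rsubst id (RRes a P) = RRes (?k a) (rsubst \<tau> P)"
    unfolding k(1) by (simp add: Let_def \<tau>_def c_def)
  ultimately show ?case
    by (metis ralpha_sym)
next
  case (RCase Cs)
  have "ralpha (rsubst id (snd c)) (snd c)" if "c \<in> set Cs" for c
    by (rule RCase.IH[OF that snds.intros])
  then have "list_all2 (rel_prod (=) ralpha) (map (\<lambda>c. (map_cond id (fst c), rsubst id (snd c))) Cs) Cs"
    unfolding list.rel_map by (intro list.rel_refl_strong) (simp only: rel_prod_sel fst_conv snd_conv cond.map_id)
  then show ?case
    by (simp only: rsubst.simps ralpha.Case)
qed (simp_all only: rsubst.simps tm.map_id ralpha.intros)

text \<open>This allows permutations of agents to be written as substitutions, so that one set of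
  closure properties covers swappings, alpha-renaming and substitution.\<close>

lemma rsubst_sperm: "sperm p \<Longrightarrow> ralpha (rsubst p P) (map_ragent p P)"
  using rsubst_perm[of id p P p id] rsubst_id[of "map_ragent p P"] sperm_id
  by (auto simp: ragent.map_id intro: ralpha_trans)

section \<open>Constructors of agents: free names, substitution and equality\<close>

lemma fn_simps [simp]:
  "fn (Output M N P) = set_tm M \<union> set_tm N \<union> fn P"
  "fn (Input M xs X P) = set_tm M \<union> ((set_pat X \<union> fn P) - set xs)"
  "fn (Res a P) = fn P - {a}"
  "fn (Par P Q) = fn P \<union> fn Q"
  "fn (Rep P) = fn P"
  "fn (Assert \<Psi>) = {}"
  by (transfer, simp)+

lemma fn_Case [simp]: "fn (Case Cs) = (\<Union>c\<in>set Cs. set_cond (fst c) \<union> fn (snd c))"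
  by transfer simp

lemma fn_subst: "fn (subst_agent \<sigma> P) = \<sigma> ` fn P"
  by transfer (rule rfn_rsubst)

lemma subst_agent_simps:
  "subst_agent \<sigma> (Output M N P) = Output (map_tm \<sigma> M) (map_tm \<sigma> N) (subst_agent \<sigma> P)"
  "subst_agent \<sigma> (Par P Q) = Par (subst_agent \<sigma> P) (subst_agent \<sigma> Q)"
  "subst_agent \<sigma> (Rep P) = Rep (subst_agent \<sigma> P)"
  "subst_agent \<sigma> (Assert \<Psi>) = Assert \<Psi>"
  by (transfer, simp add: ralpha_refl)+

lemma subst_agent_Case:
  "subst_agent \<sigma> (Case Cs) = Case (map (\<lambda>c. (map_cond \<sigma> (fst c), subst_agent \<sigma> (snd c))) Cs)"
  by transfer (simp add: ralpha_refl)

lemma subst_agent_Input: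
  assumes "\<tau> = override_on \<sigma> (fresh_renaming (set xs) (\<sigma> ` ((set_pat X \<union> fn P) - set xs))) (set xs)"
  shows "subst_agent \<sigma> (Input M xs X P) =
    Input (map_tm \<sigma> M) (map \<tau> xs) (map_pat \<tau> X) (subst_agent \<tau> P)"
  using assms by transfer (simp add: Let_def ralpha_refl)

lemma subst_agent_Res:
  assumes "\<tau> = override_on \<sigma> (fresh_renaming {a} (\<sigma> ` (fn P - {a}))) {a}"
  shows "subst_agent \<sigma> (Res a P) = Res (\<tau> a) (subst_agent \<tau> P)"
  using assms by transfer (simp add: Let_def ralpha_refl)

lemma swap_agent_eq_subst: "swap_agent a b P = subst_agent (swp a b) P"
  by transfer (rule ralpha_sym[OF rsubst_sperm[OF sperm_swp]])

lemma agent_inject: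
  "Output M N P = Output M' N' P' \<longleftrightarrow> M = M' \<and> N = N' \<and> P = P'"
  "Par P Q = Par P' Q' \<longleftrightarrow> P = P' \<and> Q = Q'"
  "Rep P = Rep P' \<longleftrightarrow> P = P'"
  by (transfer, auto elim: ralpha.cases intro: ralpha.Out ralpha.Par ralpha.Rep)+

lemma Case_inject: "Case Cs = Case Ds \<longleftrightarrow> Cs = Ds"
proof -
  have "Case Cs = Case Ds \<longleftrightarrow> list_all2 (rel_prod (=) (=)) Cs Ds"
    by transfer (auto elim: ralpha.cases intro: ralpha.Case)
  then show ?thesis
    by (simp add: list.rel_eq prod.rel_eq)
qed

lemma agent_distinct:
  "Output M N P \<noteq> Input M' xs X P'" "Output M N P \<noteq> Case Cs" "Output M N P \<noteq> Res a P'"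
  "Output M N P \<noteq> Par P' Q'" "Output M N P \<noteq> Rep P'" "Output M N P \<noteq> Assert \<Psi>"
  "Input M xs X P \<noteq> Case Cs" "Input M xs X P \<noteq> Res a P'" "Input M xs X P \<noteq> Par P' Q'"
  "Input M xs X P \<noteq> Rep P'" "Input M xs X P \<noteq> Assert \<Psi>"
  "Case Cs \<noteq> Res a P'" "Case Cs \<noteq> Par P' Q'" "Case Cs \<noteq> Rep P'" "Case Cs \<noteq> Assert \<Psi>"
  "Res a P \<noteq> Par P' Q'" "Res a P \<noteq> Rep P'" "Res a P \<noteq> Assert \<Psi>"
  "Par P Q \<noteq> Rep P'" "Par P Q \<noteq> Assert \<Psi>" "Rep P \<noteq> Assert \<Psi>"
  by (transfer, auto elim: ralpha.cases)+

lemmas agent_eq_simps = agent_inject Case_inject agent_distinct agent_distinct[symmetric]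

text \<open>A binder is injective only up to a permutation of its bound name. It acts here through
  \<open>subst_agent\<close>, as \<open>rsubst_sperm\<close> permits.\<close>

lemma Res_eqD:
  "Res a P = Res b Q \<Longrightarrow>
    \<exists>p. sperm p \<and> (\<forall>c\<in>fn P - {a}. p c = c) \<and> b = p a \<and> Q = subst_agent p P"
proof transfer
  fix a b :: "'a name" and P Q
  assume "ralpha (RRes a P) (RRes b Q)"
  then obtain p where "sperm p" "\<And>c. c \<in> rfn P - {a} \<Longrightarrow> p c = c" "b = p a" "ralpha (map_ragent p P) Q"
    by (cases rule: ralpha.cases) auto
  moreover from this have "ralpha Q (rsubst p P)"
    using ralpha_sym ralpha_trans rsubst_sperm by blast
  ultimately show "\<exists>p. sperm p \<and> (\<forall>c\<in>rfn P - {a}. p c = c) \<and> b = p a \<and> ralpha Q (rsubst p P)"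
    by blast
qed

lemma Res_alpha:
  "sperm p \<Longrightarrow> (\<forall>c\<in>fn P - {a}. p c = c) \<Longrightarrow> Res (p a) (subst_agent p P) = Res a P"
  by transfer (blast intro: ralpha_sym[OF ralpha.Res] ralpha_sym[OF rsubst_sperm])

lemma Input_eqD:
  "Input M xs X P = Input N ys Y Q \<Longrightarrow>
    \<exists>p. sperm p \<and> (\<forall>c\<in>(set_pat X \<union> fn P) - set xs. p c = c) \<and> N = M \<and> ys = map p xs \<and>
      Y = map_pat p X \<and> Q = subst_agent p P"
proof transfer
  fix M N :: "'a name tm" and xs ys X Y P Q
  assume "ralpha (RIn M xs X P) (RIn N ys Y Q)"
  then obtain p where "sperm p" "\<And>c. c \<in> (set_pat X \<union> rfn P) - set xs \<Longrightarrow> p c = c" "N = M"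
    "ys = map p xs" "Y = map_pat p X" "ralpha (map_ragent p P) Q"
    by (cases rule: ralpha.cases) auto
  moreover from this have "ralpha Q (rsubst p P)"
    using ralpha_sym ralpha_trans rsubst_sperm by blast
  ultimately show "\<exists>p. sperm p \<and> (\<forall>c\<in>(set_pat X \<union> rfn P) - set xs. p c = c) \<and> N = M \<and>
      ys = map p xs \<and> Y = map_pat p X \<and> ralpha Q (rsubst p P)"
    by blast
qed

lemma Input_alpha:
  "sperm p \<Longrightarrow> (\<forall>c\<in>(set_pat X \<union> fn P) - set xs. p c = c) \<Longrightarrow>
    Input M (map p xs) (map_pat p X) (subst_agent p P) = Input M xs X P"
  by transfer (blast intro: ralpha_sym[OF ralpha.In] ralpha_sym[OF rsubst_sperm])

section \<open>The encoding\<close>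

fun renc :: "'n rproc \<Rightarrow> 'n ragent" where
  "renc RPNil = RCase []"
| "renc (RPIn x ys P) = RIn (Nm x) ys (PTup ys) (renc P)"
| "renc (RPOut x ys P) = ROut (Nm x) (Tup ys) (renc P)"
| "renc (RPMatch a b P) = RCase [(Eq a b, renc P)]"
| "renc (RPRes x P) = RRes x (renc P)"
| "renc (RPRep P) = RRep (renc P)"
| "renc (RPPar P Q) = RPar (renc P) (renc Q)"
| "renc (RPSum P Q) = RCase [(Top, renc P), (Top, renc Q)]"

lemma renc_map: "renc (map_rproc p P) = map_ragent p (renc P)"
  by (induction P) simp_all

lemma rfn_renc: "rfn (renc P) = rpfn P"
  by (induction P) auto

text \<open>This is an equality of raw terms: the encoding preserves free names and all names of its
  patterns are bound, so both substitutions call \<open>fresh_renaming\<close> with the same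
  arguments.\<close>

lemma renc_rpsubst: "renc (rpsubst \<sigma> P) = rsubst \<sigma> (renc P)"
  by (induction P arbitrary: \<sigma>) (simp_all add: Let_def rfn_renc Un_Diff)

lemma rguarded_renc: "rguarded (renc P)"
  by (induction P) auto

lemma rwf_renc: "rpwf ob P \<Longrightarrow> rwf ob (renc P)"
  by (induction P) (auto simp: rguarded_renc)

lemma ralpha_renc: "rpalpha P Q \<Longrightarrow> ralpha (renc P) (renc Q)"
proof (induction rule: rpalpha.induct)
  case (In p P ys Q x)
  then show ?case
    using ralpha.In[of p "PTup ys" "renc P" ys "renc Q" "Nm x"]
    by (auto simp: rfn_renc renc_map Un_Diff)
next
  case (Res p P x Q)
  then show ?case
    using ralpha.Res[of p "renc P" x "renc Q"] by (auto simp: rfn_renc renc_map)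
qed (auto intro: ralpha.intros)

text \<open>Reflection of alpha-equivalence makes \<open>enc\<close> injective. Under a binder,
  \<open>renc_map\<close> shows that the permuted body is again an encoding, to which the induction
  hypothesis applies.\<close>

lemma rpalpha_renc: "ralpha A B \<Longrightarrow> A = renc P \<Longrightarrow> B = renc Q \<Longrightarrow> rpalpha P Q"
proof (induction arbitrary: P Q rule: ralpha.induct)
  case (In p X A xs B M)
  from In.prems obtain x P' Q' where "P = RPIn x xs P'" "A = renc P'" "Q = RPIn x (map p xs) Q'"
    "B = renc Q'" "X = PTup xs"
    by (cases P; cases Q) auto
  moreover from this have "rpalpha (map_rproc p P') Q'"
    by (intro In.IH) (simp_all add: renc_map)
  ultimately show ?case
    using In.hyps by (auto simp: rfn_renc intro!: rpalpha.In)
next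
  case (Res p A a B)
  from Res.prems obtain P' Q' where "P = RPRes a P'" "A = renc P'" "Q = RPRes (p a) Q'" "B = renc Q'"
    by (cases P; cases Q) auto
  moreover from this have "rpalpha (map_rproc p P') Q'"
    by (intro Res.IH) (simp_all add: renc_map)
  ultimately show ?case
    using Res.hyps by (auto simp: rfn_renc intro!: rpalpha.Res)
next
  case (Out A B M N)
  then show ?case
    by (cases P; cases Q) (auto intro: rpalpha.intros)
next
  case (Case Cs Ds)
  then show ?case
    by (cases P; cases Q) (auto intro: rpalpha.intros)
next
  case (Par A A' B B')
  then show ?case
    by (cases P; cases Q) (auto intro: rpalpha.intros)
next
  case (Rep A B)
  then show ?case
    by (cases P; cases Q) (auto intro: rpalpha.intros)
next
  case (Assert \<Psi>)
  then show ?case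
    by (cases P) auto
qed

lift_definition enc :: "'s proc \<Rightarrow> 's agent" is renc
  by (rule ralpha_renc)

lemma enc_inject: "enc P = enc Q \<longleftrightarrow> P = Q"
  by transfer (blast intro: ralpha_renc rpalpha_renc)

lemma enc_simps [simp]:
  "enc PNil = Case []"
  "enc (PIn x ys P) = Input (Nm x) ys (PTup ys) (enc P)"
  "enc (POut x ys P) = Output (Nm x) (Tup ys) (enc P)"
  "enc (PMatch a b P) = Case [(Eq a b, enc P)]"
  "enc (PRes x P) = Res x (enc P)"
  "enc (PRep P) = Rep (enc P)"
  "enc (PPar P Q) = Par (enc P) (enc Q)"
  "enc (PSum P Q) = Case [(Top, enc P), (Top, enc Q)]"
  by (transfer, simp add: ralpha_refl)+

lemma fn_enc [simp]: "fn (enc P) = pfn P"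
  by transfer (rule rfn_renc)

lemma enc_subst: "enc (subst_pi \<sigma> P) = subst_agent \<sigma> (enc P)"
  by transfer (simp add: renc_rpsubst ralpha_refl)

lemma enc_swap: "enc (swap_pi a b P) = swap_agent a b (enc P)"
  by transfer (simp add: renc_map ralpha_refl)

lemma wf_enc: "well_sorted ob P \<Longrightarrow> wf_agent ob (enc P)"
  by transfer (rule rwf_renc)

section \<open>Constructors of processes, with equality inherited from agents through the injective
  encoding\<close>

lemma proc_inject:
  "POut x ys P = POut x' ys' P' \<longleftrightarrow> x = x' \<and> ys = ys' \<and> P = P'"
  "PMatch a b P = PMatch a' b' P' \<longleftrightarrow> a = a' \<and> b = b' \<and> P = P'"
  "PRep P = PRep P' \<longleftrightarrow> P = P'"
  "PPar P Q = PPar P' Q' \<longleftrightarrow> P = P' \<and> Q = Q'"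
  "PSum P Q = PSum P' Q' \<longleftrightarrow> P = P' \<and> Q = Q'"
  by (simp_all add: agent_eq_simps flip: enc_inject)

lemma proc_induct [case_names Nil In Out Match Res Rep Par Sum]:
  assumes "\<Phi> PNil" "\<And>x ys P. \<Phi> P \<Longrightarrow> \<Phi> (PIn x ys P)" "\<And>x ys P. \<Phi> P \<Longrightarrow> \<Phi> (POut x ys P)"
    "\<And>a b P. \<Phi> P \<Longrightarrow> \<Phi> (PMatch a b P)" "\<And>x P. \<Phi> P \<Longrightarrow> \<Phi> (PRes x P)" "\<And>P. \<Phi> P \<Longrightarrow> \<Phi> (PRep P)"
    "\<And>P Q. \<Phi> P \<Longrightarrow> \<Phi> Q \<Longrightarrow> \<Phi> (PPar P Q)" "\<And>P Q. \<Phi> P \<Longrightarrow> \<Phi> Q \<Longrightarrow> \<Phi> (PSum P Q)"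
  shows "\<Phi> P"
proof (induction P rule: proc.abs_induct)
  case (1 R)
  show ?case
    by (induction R)
      (simp_all add: assms flip: PNil.abs_eq PIn.abs_eq POut.abs_eq PMatch.abs_eq PRes.abs_eq PRep.abs_eq
        PPar.abs_eq PSum.abs_eq)
qed

lemma agent_induct [case_names Output Input Case Res Par Rep Assert]:
  assumes "\<And>M N P. \<Phi> P \<Longrightarrow> \<Phi> (Output M N P)" "\<And>M xs X P. \<Phi> P \<Longrightarrow> \<Phi> (Input M xs X P)"
    "\<And>Cs. (\<And>c. c \<in> set Cs \<Longrightarrow> \<Phi> (snd c)) \<Longrightarrow> \<Phi> (Case Cs)" "\<And>a P. \<Phi> P \<Longrightarrow> \<Phi> (Res a P)"
    "\<And>P Q. \<Phi> P \<Longrightarrow> \<Phi> Q \<Longrightarrow> \<Phi> (Par P Q)" "\<And>P. \<Phi> P \<Longrightarrow> \<Phi> (Rep P)" "\<And>\<Psi>. \<Phi> (Assert \<Psi>)"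
  shows "\<Phi> P"
proof (induction P rule: agent.abs_induct)
  case (1 R)
  show ?case
  proof (induction R)
    case (RCase Cs)
    have "\<Phi> (abs_agent (snd c))" if "c \<in> set Cs" for c
      by (rule RCase.IH[OF that snds.intros])
    then have "\<Phi> (Case (map (map_prod id abs_agent) Cs))"
      by (intro assms(3)) auto
    then show ?case
      by (simp add: Case.abs_eq)
  qed (simp_all add: assms flip: Output.abs_eq Input.abs_eq Res.abs_eq Par.abs_eq Rep.abs_eq Assert.abs_eq)
qed

lemma proc_distinct:
  "PIn x ys P \<noteq> PNil" "PIn x ys P \<noteq> POut z zs Q" "PIn x ys P \<noteq> PMatch a b Q" "PIn x ys P \<noteq> PRes z Q"
  "PIn x ys P \<noteq> PRep Q" "PIn x ys P \<noteq> PPar Q R" "PIn x ys P \<noteq> PSum Q R"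
  "POut x ys P \<noteq> PNil" "POut x ys P \<noteq> PMatch a b Q" "POut x ys P \<noteq> PRes z Q"
  "POut x ys P \<noteq> PRep Q" "POut x ys P \<noteq> PPar Q R" "POut x ys P \<noteq> PSum Q R"
  "PMatch a b P \<noteq> PNil" "PMatch a b P \<noteq> PRes z Q" "PMatch a b P \<noteq> PRep Q" "PMatch a b P \<noteq> PPar Q R"
  "PMatch a b P \<noteq> PSum Q R"
  "PRes x P \<noteq> PNil" "PRes x P \<noteq> PRep Q" "PRes x P \<noteq> PPar Q R" "PRes x P \<noteq> PSum Q R"
  "PRep P \<noteq> PNil" "PRep P \<noteq> PPar Q R" "PRep P \<noteq> PSum Q R"
  "PPar P P' \<noteq> PNil" "PPar P P' \<noteq> PSum Q R" "PSum P P' \<noteq> PNil"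
  by (simp_all add: agent_eq_simps flip: enc_inject)

lemmas proc_eq_simps = proc_inject proc_distinct proc_distinct[symmetric]

lemma PRes_eqD:
  "PRes x P = PRes y Q \<Longrightarrow>
    \<exists>p. sperm p \<and> (\<forall>c\<in>pfn P - {x}. p c = c) \<and> y = p x \<and> Q = subst_pi p P"
  using Res_eqD[of x "enc P" y "enc Q"] by (simp flip: enc_inject add: enc_subst)

lemma PRes_alpha:
  "sperm p \<Longrightarrow> (\<forall>c\<in>pfn P - {x}. p c = c) \<Longrightarrow> PRes (p x) (subst_pi p P) = PRes x P"
  using Res_alpha[of p "enc P" x] by (simp flip: enc_inject add: enc_subst)

lemma PIn_eqD:
  "PIn x ys P = PIn z zs Q \<Longrightarrow>
    \<exists>p. sperm p \<and> (\<forall>c\<in>pfn P - set ys. p c = c) \<and> z = x \<and> zs = map p ys \<and> Q = subst_pi p P"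
  using Input_eqD[of "Nm x" ys "PTup ys" "enc P" "Nm z" zs "PTup zs" "enc Q"]
  by (auto simp flip: enc_inject simp add: enc_subst)

lemma PIn_alpha:
  "sperm p \<Longrightarrow> (\<forall>c\<in>pfn P - set ys. p c = c) \<Longrightarrow> PIn x (map p ys) (subst_pi p P) = PIn x ys P"
  using Input_alpha[of p "PTup ys" "enc P" ys "Nm x"] by (auto simp flip: enc_inject simp add: enc_subst)

lemma pfn_simps [simp]:
  "pfn PNil = {}" "pfn (PIn x ys P) = {x} \<union> (pfn P - set ys)" "pfn (POut x ys P) = {x} \<union> set ys \<union> pfn P"
  "pfn (PMatch a b P) = {a, b} \<union> pfn P" "pfn (PRes x P) = pfn P - {x}" "pfn (PRep P) = pfn P"
  "pfn (PPar P Q) = pfn P \<union> pfn Q" "pfn (PSum P Q) = pfn P \<union> pfn Q"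
  by (transfer, simp)+

lemma well_sorted_simps:
  "well_sorted ob PNil"
  "well_sorted ob (PIn x ys P) \<longleftrightarrow> distinct ys \<and> ob (sort_of x) = Some (map sort_of ys) \<and> well_sorted ob P"
  "well_sorted ob (POut x ys P) \<longleftrightarrow> ob (sort_of x) = Some (map sort_of ys) \<and> well_sorted ob P"
  "well_sorted ob (PMatch a b P) \<longleftrightarrow> well_sorted ob P" "well_sorted ob (PRes x P) \<longleftrightarrow> well_sorted ob P"
  "well_sorted ob (PRep P) \<longleftrightarrow> well_sorted ob P"
  "well_sorted ob (PPar P Q) \<longleftrightarrow> well_sorted ob P \<and> well_sorted ob Q"
  "well_sorted ob (PSum P Q) \<longleftrightarrow> well_sorted ob P \<and> well_sorted ob Q"
  by (transfer, simp)+

lemma subst_pi_simps: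
  "subst_pi \<sigma> PNil = PNil" "subst_pi \<sigma> (POut x ys P) = POut (\<sigma> x) (map \<sigma> ys) (subst_pi \<sigma> P)"
  "subst_pi \<sigma> (PMatch a b P) = PMatch (\<sigma> a) (\<sigma> b) (subst_pi \<sigma> P)"
  "subst_pi \<sigma> (PRep P) = PRep (subst_pi \<sigma> P)"
  "subst_pi \<sigma> (PPar P Q) = PPar (subst_pi \<sigma> P) (subst_pi \<sigma> Q)"
  "subst_pi \<sigma> (PSum P Q) = PSum (subst_pi \<sigma> P) (subst_pi \<sigma> Q)"
  by (transfer, simp add: rpalpha_refl)+

lemma subst_pi_PIn:
  assumes "\<tau> = override_on \<sigma> (fresh_renaming (set ys) (\<sigma> ` (pfn P - set ys))) (set ys)"
  shows "subst_pi \<sigma> (PIn x ys P) = PIn (\<sigma> x) (map \<tau> ys) (subst_pi \<tau> P)"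
  using assms by transfer (simp add: Let_def rpalpha_refl)

lemma subst_pi_PRes:
  assumes "\<tau> = override_on \<sigma> (fresh_renaming {x} (\<sigma> ` (pfn P - {x}))) {x}"
  shows "subst_pi \<sigma> (PRes x P) = PRes (\<tau> x) (subst_pi \<tau> P)"
  using assms by transfer (simp add: Let_def rpalpha_refl)

lemma swap_pi_eq_subst: "swap_pi a b P = subst_pi (swp a b) P"
  by (simp flip: enc_inject add: enc_swap enc_subst swap_agent_eq_subst)

section \<open>Agents representing processes\<close>

text \<open>Each name of \<open>ns\<close> occurs in a match in front of \<open>PNil\<close>, so it
  is free but enables no transition. \<open>PNil\<close> itself would lose these free names.\<close>

definition dead :: "'s name list \<Rightarrow> 's proc" where
  "dead ns = foldr (\<lambda>x. PSum (PMatch x x PNil)) ns PNil"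

lemma dead_simps: "dead [] = PNil" "dead (x # ns) = PSum (PMatch x x PNil) (dead ns)"
  by (simp_all add: dead_def)

lemma pfn_dead: "pfn (dead ns) = set ns"
  by (induction ns) (auto simp: dead_simps)

lemma subst_pi_dead: "subst_pi \<sigma> (dead ns) = dead (map \<sigma> ns)"
  by (induction ns) (auto simp: dead_simps subst_pi_simps)

lemma well_sorted_dead: "well_sorted ob (dead ns)"
  by (induction ns) (auto simp: dead_simps well_sorted_simps)

text \<open>The source of rule \<open>Alpha\<close> is arbitrary, so plain case analysis is not
  enough; in an induction on the derivation that case is closed by the induction hypothesis.\<close>

lemma no_trans_PNil: "pi_trans (PNil :: 's proc) \<beta> P' \<Longrightarrow> False"
  by (induction "PNil :: 's proc" \<beta> P' rule: pi_trans.induct) (auto simp: proc_eq_simps)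

lemma no_trans_PMatch_PNil: "pi_trans (PMatch a b PNil) \<beta> P' \<Longrightarrow> False"
  by (induction "PMatch a b PNil" \<beta> P' rule: pi_trans.induct) (auto simp: proc_eq_simps dest: no_trans_PNil)

lemma pi_trans_PSumD: "pi_trans (PSum P Q) \<beta> P' \<Longrightarrow> pi_trans P \<beta> P' \<or> pi_trans Q \<beta> P'"
  by (induction "PSum P Q" \<beta> P' rule: pi_trans.induct) (auto simp: proc_eq_simps intro: pi_trans.Alpha)

lemma no_trans_dead: "pi_trans (dead ns) \<beta> P' \<Longrightarrow> False"
  by (induction ns) (auto simp: dead_simps dest: no_trans_PNil no_trans_PMatch_PNil pi_trans_PSumD)

text \<open>\<open>Alpha\<close> may be applied repeatedly after rule \<open>Case\<close>; the
  induction moves each such application into the branch.\<close>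

lemma psi_trans_CaseD:
  "psi_trans (Case Cs :: 's agent) \<alpha> P' \<Longrightarrow> \<exists>(\<phi>, P) \<in> set Cs. entails One \<phi> \<and> psi_trans P \<alpha> P'"
proof (induction "Case Cs :: 's agent" \<alpha> P' rule: psi_trans.induct)
  case (Alpha M as N P' c d)
  then show ?case
    by (fastforce intro: psi_trans.Alpha)
qed (auto simp: agent_eq_simps)

text \<open>
  For \<open>g = False\<close> this is the graph of the encoding (on processes whose inputs bind distinct
  names). For \<open>g = True\<close> every well-formed agent represents some process. A branch guarded by
  \<open>Bot\<close> turns into an inert process with the same free names, so that the side conditions on
  bound names and the choice of fresh names in substitutions agree exactly on the two sides.
\<close>

inductive repr :: "bool \<Rightarrow> 's agent \<Rightarrow> 's proc \<Rightarrow> bool" for g where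
  Nil: "repr g (Case []) PNil"
| Input: "\<lbrakk>repr g A P; distinct ys; distinct xs; set xs = set ys; g \<or> xs = ys\<rbrakk> \<Longrightarrow>
    repr g (Input (Nm x) xs (PTup ys) A) (PIn x ys P)"
| Output: "repr g A P \<Longrightarrow> repr g (Output (Nm x) (Tup ys) A) (POut x ys P)"
| Match: "repr g A P \<Longrightarrow> repr g (Case [(Eq a b, A)]) (PMatch a b P)"
| Res: "repr g A P \<Longrightarrow> repr g (Res x A) (PRes x P)"
| Rep: "repr g A P \<Longrightarrow> repr g (Rep A) (PRep P)"
| Par: "\<lbrakk>repr g A P; repr g B Q\<rbrakk> \<Longrightarrow> repr g (Par A B) (PPar P Q)"
| Sum: "\<lbrakk>repr g A P; repr g B Q\<rbrakk> \<Longrightarrow> repr g (Case [(Top, A), (Top, B)]) (PSum P Q)"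
| Assert: "g \<Longrightarrow> repr g (Assert \<Psi>) PNil"
| Top: "\<lbrakk>g; repr g A P\<rbrakk> \<Longrightarrow> repr g (Case [(Top, A)]) (PSum P PNil)"
| Bot: "\<lbrakk>g; set ns = fn A\<rbrakk> \<Longrightarrow> repr g (Case [(Bot, A)]) (dead ns)"
| Cons: "\<lbrakk>g; repr g (Case [c]) P; repr g (Case Cs) Q\<rbrakk> \<Longrightarrow> repr g (Case (c # Cs)) (PSum P Q)"

lemma repr_fn: "repr g A P \<Longrightarrow> fn A = pfn P"
  by (induction rule: repr.induct) (auto simp: pfn_dead)

text \<open>The fresh names depend only on the set of bound names and on the free names of the body,
  and both sides agree on these by \<open>repr_fn\<close>. Hence one \<tau> serves both, even if an
  input lists its bound names in another order than its pattern.\<close>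

lemma repr_subst: "repr g A P \<Longrightarrow> repr g (subst_agent \<sigma> A) (subst_pi \<sigma> P)"
proof (induction arbitrary: \<sigma> rule: repr.induct)
  case (Input A P ys xs x)
  define \<tau> where "\<tau> = override_on \<sigma> (fresh_renaming (set ys) (\<sigma> ` (pfn P - set ys))) (set ys)"
  \<comment> \<open>On bound names the fresh renaming overrides \<sigma>, so the tuples stay
    distinct even if \<sigma> identifies names.\<close>
  have r: "inj_on (fresh_renaming (set ys) (\<sigma> ` (pfn P - set ys))) (set ys)"
    by (rule fresh_renaming) (simp_all add: finite_rpfn pfn.rep_eq)
  then have inj: "inj_on \<tau> (set ys)"
    by (simp add: \<tau>_def inj_on_def)
  have "subst_agent \<sigma> (Input (Nm x) xs (PTup ys) A) =
      Input (Nm (\<sigma> x)) (map \<tau> xs) (PTup (map \<tau> ys)) (subst_agent \<tau> A)"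
    using Input by (subst subst_agent_Input[of \<tau>]) (simp_all add: \<tau>_def Un_Diff repr_fn)
  moreover have "subst_pi \<sigma> (PIn x ys P) = PIn (\<sigma> x) (map \<tau> ys) (subst_pi \<tau> P)"
    by (rule subst_pi_PIn) (rule \<tau>_def)
  moreover have "repr g (Input (Nm (\<sigma> x)) (map \<tau> xs) (PTup (map \<tau> ys)) (subst_agent \<tau> A))
      (PIn (\<sigma> x) (map \<tau> ys) (subst_pi \<tau> P))"
    using Input inj by (intro repr.Input) (auto simp: distinct_map)
  ultimately show ?case
    by simp
next
  case (Res A P x)
  define \<tau> where "\<tau> = override_on \<sigma> (fresh_renaming {x} (\<sigma> ` (pfn P - {x}))) {x}"
  have "subst_agent \<sigma> (Res x A) = Res (\<tau> x) (subst_agent \<tau> A)"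
    by (rule subst_agent_Res) (simp add: \<tau>_def repr_fn[OF Res.hyps])
  moreover have "subst_pi \<sigma> (PRes x P) = PRes (\<tau> x) (subst_pi \<tau> P)"
    by (rule subst_pi_PRes) (rule \<tau>_def)
  ultimately show ?case
    by (simp add: repr.Res Res.IH)
next
  case (Bot ns A)
  then show ?case
    using repr.Bot[of g "map \<sigma> ns" "subst_agent \<sigma> A"]
    by (simp add: subst_agent_Case subst_pi_dead fn_subst)
qed (auto simp: subst_agent_simps subst_agent_Case subst_pi_simps intro: repr.intros)

lemma repr_enc: "well_sorted ob P \<Longrightarrow> repr g (enc P) P"
  by (induction P rule: proc_induct) (auto simp: well_sorted_simps intro: repr.intros)

lemma repr_False: "repr False A P \<Longrightarrow> A = enc P"
  by (induction rule: repr.induct) auto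

section \<open>Inversion of the representation relation\<close>

lemma repr_OutputD:
  "repr g (Output M N A) P \<Longrightarrow> \<exists>x ys P'. M = Nm x \<and> N = Tup ys \<and> P = POut x ys P' \<and> repr g A P'"
  by (erule repr.cases) (auto simp: agent_eq_simps)

lemma repr_ParD: "repr g (Par A B) R \<Longrightarrow> \<exists>P Q. R = PPar P Q \<and> repr g A P \<and> repr g B Q"
  by (erule repr.cases) (auto simp: agent_eq_simps)

lemma repr_RepD: "repr g (Rep A) R \<Longrightarrow> \<exists>P. R = PRep P \<and> repr g A P"
  by (erule repr.cases) (auto simp: agent_eq_simps)

text \<open>The rule may have been applied to another alpha-representative. The permutation relating
  the two fixes the other free names of the process as well, by \<open>repr_fn\<close>, so
  \<open>PRes_alpha\<close> permits the same change of representative there.\<close>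

lemma repr_ResD:
  assumes "repr g (Res a A) R"
  shows "\<exists>P. R = PRes a P \<and> repr g A P"
  using assms
proof (cases rule: repr.cases)
  case (Res A' P' x)
  then obtain p where p: "sperm p" "\<forall>c\<in>fn A' - {x}. p c = c" "a = p x" "A = subst_agent p A'"
    using Res_eqD[of x A' a A] by auto
  then have "R = PRes a (subst_pi p P')"
    using Res PRes_alpha[of p P' x] by (simp add: repr_fn)
  then show ?thesis
    using Res p repr_subst by blast
qed (auto simp: agent_eq_simps)

lemma repr_InputD:
  assumes "repr g (Input M xs X A) R"
  shows "\<exists>x ys P. M = Nm x \<and> X = PTup ys \<and> R = PIn x ys P \<and> repr g A P \<and> distinct ys \<and> distinct xs \<and>
    set xs = set ys"
  using assms
proof (cases rule: repr.cases)
  case (Input A' P' ys' xs' x)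
  then obtain p where p: "sperm p" "\<forall>c\<in>fn A' - set ys'. p c = c" "M = Nm x" "xs = map p xs'"
    "X = map_pat p (PTup ys')" "A = subst_agent p A'"
    using Input_eqD[of "Nm x" xs' "PTup ys'" A' M xs X A] by (auto simp: Un_Diff)
  then have "R = PIn x (map p ys') (subst_pi p P')"
    using Input PIn_alpha[of p P' ys' x] by (simp add: repr_fn)
  moreover have "inj_on p (set ys')"
    using p(1) sperm_inj inj_on_subset by blast
  ultimately show ?thesis
    using Input p by (auto simp: repr_subst distinct_map)
qed (auto simp: agent_eq_simps)

lemma dead_distinct:
  "dead ns \<noteq> POut x ys P" "dead ns \<noteq> PIn x ys P" "dead ns \<noteq> PMatch a b P" "dead ns \<noteq> PRes x P"
  "dead ns \<noteq> PRep P" "dead ns \<noteq> PPar P Q"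
  by (cases ns; simp add: dead_simps proc_eq_simps)+

lemmas repr_proc_simps = proc_eq_simps dead_distinct dead_distinct[symmetric]

lemma repr_POutD: "repr g A (POut x ys P) \<Longrightarrow> \<exists>B. A = Output (Nm x) (Tup ys) B \<and> repr g B P"
  by (erule repr.cases) (auto simp: repr_proc_simps)

lemma repr_PMatchD: "repr g A (PMatch a b P) \<Longrightarrow> \<exists>B. A = Case [(Eq a b, B)] \<and> repr g B P"
  by (erule repr.cases) (auto simp: repr_proc_simps)

lemma repr_PParD: "repr g A (PPar P Q) \<Longrightarrow> \<exists>B C. A = Par B C \<and> repr g B P \<and> repr g C Q"
  by (erule repr.cases) (auto simp: repr_proc_simps)

lemma repr_PRepD: "repr g A (PRep P) \<Longrightarrow> \<exists>B. A = Rep B \<and> repr g B P"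
  by (erule repr.cases) (auto simp: repr_proc_simps)

text \<open>A sum can stem from four rules of \<open>repr\<close>. In the last alternative it is
  inert, which conflicts with any transition of it.\<close>

lemma repr_PSumD:
  "repr g A (PSum P Q) \<Longrightarrow>
    (\<exists>B C. A = Case [(Top, B), (Top, C)] \<and> repr g B P \<and> repr g C Q) \<or>
    (\<exists>B. A = Case [(Top, B)] \<and> repr g B P \<and> Q = PNil) \<or>
    (\<exists>c Cs. A = Case (c # Cs) \<and> repr g (Case [c]) P \<and> repr g (Case Cs) Q) \<or>
    (\<exists>ns. PSum P Q = dead ns)"
  by (erule repr.cases) (auto simp: repr_proc_simps)

lemma repr_PResD:
  assumes "repr g A (PRes x P)"
  shows "\<exists>B. A = Res x B \<and> repr g B P"
  using assms
proof (cases rule: repr.cases)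
  case (Res B' P' x')
  then obtain p where p: "sperm p" "\<forall>c\<in>pfn P' - {x'}. p c = c" "x = p x'" "P = subst_pi p P'"
    using PRes_eqD[of x' P' x P] by auto
  then have "A = Res x (subst_agent p B')"
    using Res Res_alpha[of p B' x'] by (simp add: repr_fn)
  then show ?thesis
    using Res p repr_subst by blast
qed (auto simp: repr_proc_simps)

lemma repr_PInD:
  assumes "repr g A (PIn x ys P)"
  shows "\<exists>xs B. A = Input (Nm x) xs (PTup ys) B \<and> repr g B P \<and> distinct ys \<and> distinct xs \<and>
    set xs = set ys"
  using assms
proof (cases rule: repr.cases)
  case (Input B' P' ys' xs' x')
  then obtain p where p: "sperm p" "\<forall>c\<in>pfn P' - set ys'. p c = c" "x = x'" "ys = map p ys'"
    "P = subst_pi p P'"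
    using PIn_eqD[of x' ys' P' x ys P] by auto
  then have "A = Input (Nm x) (map p xs') (PTup ys) (subst_agent p B')"
    using Input Input_alpha[of p "PTup ys'" B' xs' "Nm x'"] by (simp add: repr_fn Un_Diff)
  moreover have "inj_on p (set ys')"
    using p(1) sperm_inj inj_on_subset by blast
  ultimately show ?thesis
    using Input p by (intro exI[of _ "map p xs'"] exI[of _ "subst_agent p B'"])
      (auto simp: repr_subst distinct_map)
qed (auto simp: repr_proc_simps)

text \<open>A sum inherits the transitions of its summands, so it suffices to locate the summand
  belonging to the enabled branch. For a condition \<open>Eq a b\<close>, being enabled means that
  the two names coincide, as the rule for matches demands.\<close>

lemma repr_CaseD:
  "repr g (Case Cs) P \<Longrightarrow> (\<phi>, A) \<in> set Cs \<Longrightarrow> entails One \<phi> \<Longrightarrow>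
    \<exists>P0. repr g A P0 \<and> (\<forall>\<beta> P'. pi_trans P0 \<beta> P' \<longrightarrow> pi_trans P \<beta> P')"
proof (induction "Case Cs" P arbitrary: Cs rule: repr.induct)
  case (Cons c P Cs' Q)
  then consider "(\<phi>, A) \<in> set [c]" | "(\<phi>, A) \<in> set Cs'"
    by (auto simp: agent_eq_simps)
  then show ?case
  proof cases
    case 1
    then obtain P0 where "repr g A P0" "\<And>\<beta> P'. pi_trans P0 \<beta> P' \<Longrightarrow> pi_trans P \<beta> P'"
      using Cons(3)[OF refl] Cons.prems(2) by blast
    then show ?thesis
      by (blast intro: pi_trans.SumL)
  next
    case 2
    then obtain P0 where "repr g A P0" "\<And>\<beta> P'. pi_trans P0 \<beta> P' \<Longrightarrow> pi_trans Q \<beta> P'"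
      using Cons(5)[OF refl] Cons.prems(2) by blast
    then show ?thesis
      by (blast intro: pi_trans.SumR)
  qed
next
  case (Match B P a b)
  then have "A = B" "a = b"
    by (auto simp: agent_eq_simps)
  with Match(1) show ?case
    by (blast intro: pi_trans.Match)
next
  case (Sum B P C Q)
  then have "A = B \<or> A = C"
    by (auto simp: agent_eq_simps)
  with Sum(1,3) show ?case
    by (blast intro: pi_trans.SumL pi_trans.SumR)
next
  case (Top B P)
  then have "A = B"
    by (auto simp: agent_eq_simps)
  with Top(2) show ?case
    by (blast intro: pi_trans.SumL)
qed (auto simp: agent_eq_simps)

lemma repr_foldr_Res: "repr g A P \<Longrightarrow> repr g (foldr Res as A) (foldr PRes as P)"
  by (induction as) (auto intro: repr.Res)

section \<open>Input objects and substitutions\<close>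

lemma sort_of_name_subst:
  "map sort_of xs = map sort_of ls \<Longrightarrow> sort_of (name_subst xs ls a) = sort_of a"
proof -
  assume eq: "map sort_of xs = map sort_of ls"
  have "sort_of b = sort_of a" if "(a, b) \<in> set (zip xs ls)" for b
    using that eq by (auto simp: in_set_zip list_eq_iff_nth_eq)
  then show ?thesis
    by (auto simp: name_subst_def dest!: map_of_SomeD split: option.split)
qed

text \<open>Permuting both lists permutes the list of pairs, and with distinct keys
  \<open>map_of\<close> depends only on the set of pairs.\<close>

lemma name_subst_permute:
  assumes "p permutes {..<length ys}" "distinct ys" "length as = length ys"
  shows "name_subst (permute_list p ys) (permute_list p as) = name_subst ys as"
proof -
  let ?zs = "zip ys as"
  have "zip (permute_list p ys) (permute_list p as) = permute_list p ?zs"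
    using assms by (simp add: permute_list_zip)
  moreover have "map_of (permute_list p ?zs) = map_of ?zs"
    using assms by (subst map_of_inject_set) (simp_all flip: permute_list_map)
  ultimately show ?thesis
    by (simp add: name_subst_def fun_eq_iff)
qed

lemma MatchD:
  assumes "L \<in> Match N xs (PTup ys)"
  shows "\<exists>as p. N = Tup as \<and> L = permute_list p as \<and> xs = permute_list p ys \<and> p permutes {..<length ys} \<and>
    map sort_of as = map sort_of ys"
  using assms by (auto simp: Match_def)

text \<open>The permutation of positions acts on the bound names and on the received names alike and
  cancels in the substitution, which is therefore that of the pi-calculus.\<close>

lemma Match_name_subst:
  assumes "L \<in> Match N xs (PTup ys)" "distinct ys"
  shows "\<exists>as. N = Tup as \<and> map sort_of as = map sort_of ys \<and> name_subst xs L = name_subst ys as"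
proof -
  obtain as p where *: "N = Tup as" "L = permute_list p as" "xs = permute_list p ys"
    "p permutes {..<length ys}" "map sort_of as = map sort_of ys"
    using MatchD[OF assms(1)] by auto
  moreover have "length as = length ys"
    using *(5) by (metis length_map)
  ultimately show ?thesis
    using assms(2) by (auto simp: name_subst_permute)
qed

text \<open>Two repetition-free lists of the same names differ by a permutation of positions;
  applying it to the received tuple gives the required match.\<close>

lemma ex_Match:
  assumes "distinct xs" "distinct ys" "set xs = set ys" "map sort_of zs = map sort_of ys"
  shows "\<exists>L\<in>Match (Tup zs) xs (PTup ys). name_subst xs L = name_subst ys zs"
proof -
  have "mset xs = mset ys"
    using assms by (simp add: set_eq_iff_mset_eq_distinct)
  then obtain p where "p permutes {..<length ys}" "permute_list p ys = xs"
    by (rule mset_eq_permutation)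
  moreover have "length zs = length ys"
    using assms(4) by (metis length_map)
  ultimately show ?thesis
    using assms by (intro bexI[of _ "permute_list p zs"]) (auto simp: Match_def name_subst_permute)
qed

section \<open>Preservation of well-formedness and well-sortedness\<close>

lemma rguarded_rsubst: "rguarded (rsubst \<sigma> P) = rguarded P"
  by (induction P arbitrary: \<sigma>) (auto simp: Let_def snds.intros)

text \<open>Preserved sorts keep prefixes well-formed. Distinctness of patterns survives a
  non-injective \<sigma> because the bound names are renamed injectively.\<close>

lemma rwf_rsubst: "(\<And>a. sort_of (\<sigma> a) = sort_of a) \<Longrightarrow> rwf ob P \<Longrightarrow> rwf ob (rsubst \<sigma> P)"
proof (induction P arbitrary: \<sigma>)
  case (RIn M xs X P)
  define r where "r = fresh_renaming (set xs) (\<sigma> ` ((set_pat X \<union> rfn P) - set xs))"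
  define \<tau> where "\<tau> = override_on \<sigma> r (set xs)"
  have r: "inj_on r (set xs)" "\<And>a. a \<in> set xs \<Longrightarrow> sort_of (r a) = sort_of a"
    unfolding r_def by (intro fresh_renaming; simp add: finite_rfn finite_set_tm)+
  have \<tau>: "inj_on \<tau> (set xs)" "sort_of (\<tau> a) = sort_of a" for a
    using r RIn.prems by (auto simp: \<tau>_def inj_on_def override_on_def)
  have "sort_tm (map_tm \<sigma> M) = sort_tm M"
    using RIn.prems by (cases M) auto
  moreover have "sort_pat (map_pat \<tau> X) = sort_pat X" "distinct_pat (map_pat \<tau> X)"
    using RIn.prems \<tau> by (cases X; auto simp: distinct_map)+
  moreover have "rwf ob (rsubst \<tau> P)"
    using RIn \<tau> by auto
  ultimately have "rwf ob (RIn (map_tm \<sigma> M) (map \<tau> xs) (map_pat \<tau> X) (rsubst \<tau> P))"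
    using RIn.prems \<tau> by (auto simp: distinct_map pat.set_map)
  then show ?case
    by (simp only: rsubst.simps Let_def \<tau>_def r_def)
next
  case (RRes a P)
  define r where "r = fresh_renaming {a} (\<sigma> ` (rfn P - {a}))"
  have "sort_of (r a) = sort_of a"
    unfolding r_def by (intro fresh_renaming) (simp_all add: finite_rfn)
  then have "sort_of (override_on \<sigma> r {a} b) = sort_of b" for b
    using RRes.prems by (simp add: override_on_def)
  then have "rwf ob (RRes (r a) (rsubst (override_on \<sigma> r {a}) P))"
    using RRes by simp
  then show ?case
    by (simp add: Let_def r_def)
next
  case (ROut M N P)
  then have "sort_tm (map_tm \<sigma> L) = sort_tm L" for L
    by (cases L) auto
  with ROut show ?case
    by simp
qed (auto simp: rguarded_rsubst snds.intros)

lemma wf_agent_subst: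
  "(\<And>a. sort_of (\<sigma> a) = sort_of a) \<Longrightarrow> wf_agent ob P \<Longrightarrow> wf_agent ob (subst_agent \<sigma> P)"
  by transfer (rule rwf_rsubst)

lemma wf_foldr_Res: "wf_agent ob (foldr Res as P) = wf_agent ob P"
  by (induction as) (auto simp: wf_agent_simps)

lemma psi_trans_wf: "psi_trans P \<alpha> P' \<Longrightarrow> wf_agent ob P \<Longrightarrow> wf_agent ob P'"
proof (induction rule: psi_trans.induct)
  case (In M K L N ys X P)
  obtain zs where X: "X = PTup zs"
    by (cases X)
  then obtain as p where "L = permute_list p as" "ys = permute_list p zs" "p permutes {..<length zs}"
    "map sort_of as = map sort_of zs"
    using MatchD[of L N ys zs] In.hyps(2) by auto
  moreover from this have "length as = length zs"
    by (metis length_map)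
  \<comment> \<open>One permutation reorders both lists, so their sorts still agree entry by entry
    and the input substitution preserves sorts.\<close>
  ultimately have "map sort_of ys = map sort_of L"
    by (simp flip: permute_list_map)
  then show ?case
    using In.prems by (auto simp: wf_agent_simps intro!: wf_agent_subst sort_of_name_subst)
next
  case (Alpha P M as N P' c d)
  then show ?case
    by (auto simp: swap_agent_eq_subst sort_of_sperm sperm_swp intro!: wf_agent_subst)
qed (auto simp: wf_agent_simps wf_agent_Case wf_foldr_Res)

lemma repr_well_sorted: "repr g A P \<Longrightarrow> wf_agent ob A \<Longrightarrow> well_sorted ob P"
  by (induction rule: repr.induct)
    (auto simp: wf_agent_simps wf_agent_Case well_sorted_simps well_sorted_dead)

section \<open>Matching transitions\<close>

text \<open>A set of bound names corresponds to every repetition-free list of its elements, as only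
  the psi-calculus records an order.\<close>

fun corr :: "'n paction \<Rightarrow> 'n action \<Rightarrow> bool" where
  "corr (POutA Y z ys) \<alpha> \<longleftrightarrow> (\<exists>as. \<alpha> = OutA (Nm z) as (Tup ys) \<and> distinct as \<and> set as = Y)"
| "corr (PInA x zs) \<alpha> \<longleftrightarrow> \<alpha> = InA (Nm x) (Tup zs)"
| "corr PTau \<alpha> \<longleftrightarrow> \<alpha> = Tau"

lemma corr_bn: "corr \<beta> \<alpha> \<Longrightarrow> bn \<alpha> = pbn \<beta>"
  by (cases \<beta>) auto

lemma corr_names: "corr \<beta> \<alpha> \<Longrightarrow> set_action \<alpha> = pnames \<beta>"
  by (cases \<beta>) auto

lemma corr_OutA:
  "corr \<beta> (OutA M as N) \<longleftrightarrow> (\<exists>z ys. \<beta> = POutA (set as) z ys \<and> M = Nm z \<and> N = Tup ys \<and> distinct as)"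
  by (cases \<beta>) auto

lemma corr_InA: "corr \<beta> (InA M N) \<longleftrightarrow> (\<exists>x zs. \<beta> = PInA x zs \<and> M = Nm x \<and> N = Tup zs)"
  by (cases \<beta>) auto

lemma corr_swap: "corr \<beta> \<alpha> \<Longrightarrow> corr (swap_paction a b \<beta>) (map_action (swp a b) \<alpha>)"
  by (cases \<beta>) (auto simp: distinct_map inj_on_subset[OF sperm_inj[OF sperm_swp]])

lemma entails_chan_eq_Nm: "entails One (chan_eq (Nm x) K) \<longleftrightarrow> K = Nm x"
  by (cases K) auto

text \<open>Each psi rule is answered by its pi counterpart, the inversion lemmas supplying the
  shape of the process. Leaving \<open>g\<close> arbitrary covers both the encoding and the agents
  treated for completeness.\<close>

lemma psi_trans_imp_pi_trans:
  "psi_trans A \<alpha> A' \<Longrightarrow> repr g A P \<Longrightarrow> \<exists>\<beta> P'. pi_trans P \<beta> P' \<and> corr \<beta> \<alpha> \<and> repr g A' P'"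
proof (induction arbitrary: P rule: psi_trans.induct)
  case (In M K L N xs X A)
  obtain x ys P0 where x: "M = Nm x" "X = PTup ys" "P = PIn x ys P0" "repr g A P0" "distinct ys"
    using repr_InputD[OF In.prems] by auto
  then obtain as where as: "N = Tup as" "map sort_of as = map sort_of ys"
    "name_subst xs L = name_subst ys as"
    using Match_name_subst In.hyps(2) by blast
  have "pi_trans P (PInA x as) (subst_pi (name_subst ys as) P0)"
    unfolding x by (rule pi_trans.In) (rule as)
  moreover have "corr (PInA x as) (InA K N)"
    using In.hyps(1) as x by (simp add: entails_chan_eq_Nm)
  ultimately show ?case
    using repr_subst[OF x(4)] as(3) by metis
next
  case (Out M K N A)
  obtain x ys P0 where x: "M = Nm x" "N = Tup ys" "P = POut x ys P0" "repr g A P0"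
    using repr_OutputD[OF Out.prems] by auto
  moreover have "K = Nm x"
    using Out.hyps x by (simp add: entails_chan_eq_Nm)
  ultimately show ?case
    by (auto simp: corr_OutA intro!: exI pi_trans.Out)
next
  case (ComL A M as N A' B K B')
  obtain Q R where P: "P = PPar Q R" "repr g A Q" "repr g B R"
    using repr_ParD[OF ComL.prems] by auto
  obtain z ys Q' where Q': "pi_trans Q (POutA (set as) z ys) Q'" "repr g A' Q'" "M = Nm z" "N = Tup ys"
    "distinct as"
    using ComL.IH(1)[OF P(2)] by (auto simp: corr_OutA)
  \<comment> \<open>Channel equivalence of names is equality, so the partner receives on the same
    name \<open>z\<close>.\<close>
  moreover obtain R' where "pi_trans R (PInA z ys) R'" "repr g B' R'"
    using ComL.IH(2)[OF P(3)] ComL.hyps Q' by (auto simp: corr_InA entails_chan_eq_Nm)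
  moreover have "set as \<inter> pfn R = {}"
    using ComL.hyps repr_fn[OF P(3)] by simp
  \<comment> \<open>The restrictions of the pi derivative are put in the order \<open>as\<close>, so
    that the two derivatives correspond binder by binder.\<close>
  ultimately show ?case
    unfolding P(1) by (intro exI[of _ PTau] exI[of _ "foldr PRes as (PPar Q' R')"])
      (auto intro!: pi_trans.ComL repr_foldr_Res repr.Par)
next
  case (ComR A K N A' B M as B')
  obtain Q R where P: "P = PPar Q R" "repr g A Q" "repr g B R"
    using repr_ParD[OF ComR.prems] by auto
  obtain z ys R' where R': "pi_trans R (POutA (set as) z ys) R'" "repr g B' R'" "M = Nm z" "N = Tup ys"
    "distinct as"
    using ComR.IH(2)[OF P(3)] by (auto simp: corr_OutA)
  moreover obtain Q' where "pi_trans Q (PInA z ys) Q'" "repr g A' Q'"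
    using ComR.IH(1)[OF P(2)] ComR.hyps R' by (auto simp: corr_InA entails_chan_eq_Nm)
  moreover have "set as \<inter> pfn Q = {}"
    using ComR.hyps repr_fn[OF P(2)] by simp
  ultimately show ?case
    unfolding P(1) by (intro exI[of _ PTau] exI[of _ "foldr PRes as (PPar Q' R')"])
      (auto intro!: pi_trans.ComR repr_foldr_Res repr.Par)
next
  case (ParL A \<alpha> A' B)
  obtain Q R where P: "P = PPar Q R" "repr g A Q" "repr g B R"
    using repr_ParD[OF ParL.prems] by auto
  obtain \<beta> Q' where "pi_trans Q \<beta> Q'" "corr \<beta> \<alpha>" "repr g A' Q'"
    using ParL.IH[OF P(2)] by auto
  moreover from this have "pbn \<beta> \<inter> pfn R = {}"
    using ParL.hyps by (simp add: corr_bn repr_fn[OF P(3)])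
  ultimately show ?case
    using P by (blast intro: pi_trans.ParL repr.Par)
next
  case (ParR B \<alpha> B' A)
  obtain Q R where P: "P = PPar Q R" "repr g A Q" "repr g B R"
    using repr_ParD[OF ParR.prems] by auto
  obtain \<beta> R' where "pi_trans R \<beta> R'" "corr \<beta> \<alpha>" "repr g B' R'"
    using ParR.IH[OF P(3)] by auto
  moreover from this have "pbn \<beta> \<inter> pfn Q = {}"
    using ParR.hyps by (simp add: corr_bn repr_fn[OF P(2)])
  ultimately show ?case
    using P by (blast intro: pi_trans.ParR repr.Par)
next
  case (Case \<phi> A Cs \<alpha> A')
  then show ?case
    using repr_CaseD[OF Case.prems Case.hyps(1,2)] by blast
next
  case (Rep A \<alpha> A')
  obtain Q where Q: "P = PRep Q" "repr g A Q"
    using repr_RepD[OF Rep.prems] by auto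
  then show ?case
    using Rep.IH[of "PPar Q (PRep Q)"] by (blast intro: repr.Rep repr.Par pi_trans.Rep)
next
  case (Scope A \<alpha> A' b)
  obtain Q where Q: "P = PRes b Q" "repr g A Q"
    using repr_ResD[OF Scope.prems] by auto
  obtain \<beta> Q' where "pi_trans Q \<beta> Q'" "corr \<beta> \<alpha>" "repr g A' Q'"
    using Scope.IH[OF Q(2)] by auto
  then show ?case
    using Q(1) Scope.hyps(2) by (metis corr_names pi_trans.Res repr.Res)
next
  case (Open A M as cs N A' b)
  obtain Q where Q: "P = PRes b Q" "repr g A Q"
    using repr_ResD[OF Open.prems] by auto
  obtain z ys Q' where Q': "pi_trans Q (POutA (set (as @ cs)) z ys) Q'" "repr g A' Q'" "M = Nm z"
    "N = Tup ys" "distinct (as @ cs)"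
    using Open.IH[OF Q(2)] by (auto simp: corr_OutA)
  have "pi_trans P (POutA (insert b (set (as @ cs))) z ys) Q'"
    unfolding Q(1) using Q' Open.hyps by (intro pi_trans.Open) auto
  moreover have "corr (POutA (insert b (set (as @ cs))) z ys) (OutA M (as @ b # cs) N)"
    using Q' Open.hyps by auto
  ultimately show ?case
    using Q'(2) by blast
next
  case (Alpha A M as N A' c d)
  obtain z ys P' where P': "pi_trans P (POutA (set as) z ys) P'" "repr g A' P'" "M = Nm z" "N = Tup ys"
    "distinct as"
    using Alpha.IH[OF Alpha.prems] by (auto simp: corr_OutA)
  have "pi_trans P (POutA (swp c d ` set as) z (map (swp c d) ys)) (swap_pi c d P')"
    using P' Alpha.hyps by (intro pi_trans.Alpha) (auto simp: repr_fn)
  moreover have "repr g (swap_agent c d A') (swap_pi c d P')"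
    using P'(2) by (simp add: swap_agent_eq_subst swap_pi_eq_subst repr_subst)
  moreover have "corr (POutA (swp c d ` set as) z (map (swp c d) ys))
      (OutA M (map (swp c d) as) (map_tm (swp c d) N))"
    using P' by (auto simp: distinct_map inj_on_subset[OF sperm_inj[OF sperm_swp]])
  ultimately show ?case
    by blast
qed

text \<open>The psi action is given, not merely shown to exist: every order of the bound names must
  be attainable, both for communication, where the restrictions have a prescribed order, and for
  bisimulation, where the exact action has to be answered.\<close>

lemma pi_trans_imp_psi_trans:
  "pi_trans P \<beta> P' \<Longrightarrow> repr g A P \<Longrightarrow> corr \<beta> \<alpha> \<Longrightarrow> \<exists>A'. psi_trans A \<alpha> A' \<and> repr g A' P'"
proof (induction arbitrary: A \<alpha> rule: pi_trans.induct)
  case (Out x ys P)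
  obtain B where B: "A = Output (Nm x) (Tup ys) B" "repr g B P"
    using repr_POutD[OF Out.prems(1)] by auto
  then show ?case
    using Out.prems(2) psi_trans.Out[of "Nm x" "Nm x" "Tup ys" B] by auto
next
  case (In zs ys x P)
  obtain xs B where B: "A = Input (Nm x) xs (PTup ys) B" "repr g B P" "distinct ys" "distinct xs"
    "set xs = set ys"
    using repr_PInD[OF In.prems(1)] by auto
  obtain L where L: "L \<in> Match (Tup zs) xs (PTup ys)" "name_subst xs L = name_subst ys zs"
    using ex_Match[of xs ys zs] B In.hyps by auto
  have "psi_trans A (InA (Nm x) (Tup zs)) (subst_agent (name_subst xs L) B)"
    unfolding B(1) by (rule psi_trans.In) (simp_all add: L)
  then show ?case
    using In.prems(2) L(2) repr_subst[OF B(2)] by auto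
next
  case (SumL P \<beta> P' Q)
  from repr_PSumD[OF SumL.prems(1)] show ?case
  proof (elim disjE exE conjE)
    fix B C assume B: "A = Case [(Top, B), (Top, C)]" "repr g B P"
    then show ?thesis
      using SumL.IH[OF B(2) SumL.prems(2)] by (auto intro!: psi_trans.Case)
  next
    fix B assume B: "A = Case [(Top, B)]" "repr g B P"
    then show ?thesis
      using SumL.IH[OF B(2) SumL.prems(2)] by (auto intro!: psi_trans.Case)
  next
    fix c Cs assume A: "A = Case (c # Cs)" "repr g (Case [c]) P"
    then obtain A' where A': "psi_trans (Case [c]) \<alpha> A'" "repr g A' P'"
      using SumL.IH SumL.prems(2) by blast
    \<comment> \<open>The enabled branch of the one-branch case is also a branch of the whole
      case.\<close>
    then have "psi_trans A \<alpha> A'"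
      using psi_trans_CaseD[OF A'(1)] A(1) by (auto intro: psi_trans.Case)
    then show ?thesis
      using A'(2) by blast
  next
    fix ns assume "PSum P Q = dead ns"
    then show ?thesis
      using pi_trans.SumL[OF SumL.hyps, of Q] no_trans_dead by metis
  qed
next
  case (SumR Q \<beta> Q' P)
  from repr_PSumD[OF SumR.prems(1)] show ?case
  proof (elim disjE exE conjE)
    fix B C assume B: "A = Case [(Top, B), (Top, C)]" "repr g C Q"
    then show ?thesis
      using SumR.IH[OF B(2) SumR.prems(2)] by (auto intro!: psi_trans.Case)
  next
    assume "Q = PNil"
    then show ?thesis
      using SumR.hyps no_trans_PNil by blast
  next
    fix c Cs assume A: "A = Case (c # Cs)" "repr g (Case Cs) Q"
    then obtain A' where A': "psi_trans (Case Cs) \<alpha> A'" "repr g A' Q'"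
      using SumR.IH SumR.prems(2) by blast
    then have "psi_trans A \<alpha> A'"
      using psi_trans_CaseD[OF A'(1)] A(1) by (auto intro: psi_trans.Case)
    then show ?thesis
      using A'(2) by blast
  next
    fix ns assume "PSum P Q = dead ns"
    then show ?thesis
      using pi_trans.SumR[OF SumR.hyps, of P] no_trans_dead by metis
  qed
next
  case (Match P \<beta> P' x)
  obtain B where B: "A = Case [(Eq x x, B)]" "repr g B P"
    using repr_PMatchD[OF Match.prems(1)] by auto
  then show ?case
    using Match.IH[OF B(2) Match.prems(2)] by (auto intro!: psi_trans.Case)
next
  case (ParL P \<beta> P' Q)
  obtain B C where B: "A = Par B C" "repr g B P" "repr g C Q"
    using repr_PParD[OF ParL.prems(1)] by auto
  obtain B' where "psi_trans B \<alpha> B'" "repr g B' P'"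
    using ParL.IH[OF B(2) ParL.prems(2)] by auto
  moreover have "bn \<alpha> \<inter> fn C = {}"
    using ParL.hyps ParL.prems by (simp add: corr_bn repr_fn[OF B(3)])
  ultimately show ?case
    using B by (blast intro: psi_trans.ParL repr.Par)
next
  case (ParR Q \<beta> Q' P)
  obtain B C where B: "A = Par B C" "repr g B P" "repr g C Q"
    using repr_PParD[OF ParR.prems(1)] by auto
  obtain C' where "psi_trans C \<alpha> C'" "repr g C' Q'"
    using ParR.IH[OF B(3) ParR.prems(2)] by auto
  moreover have "bn \<alpha> \<inter> fn B = {}"
    using ParR.hyps ParR.prems by (simp add: corr_bn repr_fn[OF B(2)])
  ultimately show ?case
    using B by (blast intro: psi_trans.ParR repr.Par)
next
  case (Res P \<beta> P' x)
  obtain B where B: "A = Res x B" "repr g B P"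
    using repr_PResD[OF Res.prems(1)] by auto
  then show ?case
    using Res.IH[OF B(2) Res.prems(2)] Res.hyps(2) corr_names[OF Res.prems(2)]
    by (auto intro!: psi_trans.Scope repr.Res)
next
  case (Rep P \<beta> P')
  obtain B where B: "A = Rep B" "repr g B P"
    using repr_PRepD[OF Rep.prems(1)] by auto
  then show ?case
    using Rep.IH[of "Par B (Rep B)" \<alpha>] Rep.prems(2) by (blast intro: repr.Rep repr.Par psi_trans.Rep)
next
  case (ComL P Y x ys P' Q Q' bs)
  obtain B C where B: "A = Par B C" "repr g B P" "repr g C Q"
    using repr_PParD[OF ComL.prems(1)] by auto
  \<comment> \<open>The induction hypothesis is used for the order \<open>bs\<close> in which the
    derivative restricts the extruded names.\<close>
  obtain B' where "psi_trans B (OutA (Nm x) bs (Tup ys)) B'" "repr g B' P'"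
    using ComL.IH(1)[OF B(2)] ComL.hyps by auto
  moreover obtain C' where "psi_trans C (InA (Nm x) (Tup ys)) C'" "repr g C' Q'"
    using ComL.IH(2)[OF B(3)] by auto
  moreover have "set bs \<inter> fn C = {}"
    using ComL.hyps by (simp add: repr_fn[OF B(3)])
  ultimately show ?case
    using B ComL.prems(2)
    by (intro exI[of _ "foldr Res bs (Par B' C')"])
      (auto intro!: psi_trans.ComL[of B "Nm x"] repr_foldr_Res repr.Par)
next
  case (ComR P x ys P' Q Y Q' bs)
  obtain B C where B: "A = Par B C" "repr g B P" "repr g C Q"
    using repr_PParD[OF ComR.prems(1)] by auto
  obtain C' where "psi_trans C (OutA (Nm x) bs (Tup ys)) C'" "repr g C' Q'"
    using ComR.IH(2)[OF B(3)] ComR.hyps by auto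
  moreover obtain B' where "psi_trans B (InA (Nm x) (Tup ys)) B'" "repr g B' P'"
    using ComR.IH(1)[OF B(2)] by auto
  moreover have "set bs \<inter> fn B = {}"
    using ComR.hyps by (simp add: repr_fn[OF B(2)])
  ultimately show ?case
    using B ComR.prems(2)
    by (intro exI[of _ "foldr Res bs (Par B' C')"])
      (auto intro!: psi_trans.ComR[of B "Nm x"] repr_foldr_Res repr.Par)
next
  case (Open P Y z ys P' x)
  obtain B where B: "A = Res x B" "repr g B P"
    using repr_PResD[OF Open.prems(1)] by auto
  obtain ds where ds: "\<alpha> = OutA (Nm z) ds (Tup ys)" "distinct ds" "set ds = insert x Y"
    using Open.prems(2) by auto
  \<comment> \<open>The requested order \<open>ds\<close> dictates where \<open>Open\<close> has to
    insert \<open>x\<close>; without \<open>x\<close> it is a listing of \<open>Y\<close> for the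
    induction hypothesis.\<close>
  then obtain as cs where as: "ds = as @ x # cs"
    using split_list[of x ds] by auto
  moreover have "set (as @ cs) = Y" "distinct (as @ cs)"
    using ds Open.hyps by (auto simp: as)
  ultimately obtain B' where "psi_trans B (OutA (Nm z) (as @ cs) (Tup ys)) B'" "repr g B' P'"
    using Open.IH[OF B(2), of "OutA (Nm z) (as @ cs) (Tup ys)"] by auto
  moreover from this have "psi_trans A \<alpha> B'"
    using Open.hyps ds unfolding B(1) ds(1) as by (intro psi_trans.Open) (auto simp: as)
  ultimately show ?case
    by blast
next
  case (Alpha P Y z ys P' c d)
  have swp2: "swp c d (swp c d a) = a" for a
    by (simp add: swp_def)
  obtain ds where ds: "\<alpha> = OutA (Nm z) ds (Tup (map (swp c d) ys))" "distinct ds" "set ds = swp c d ` Y"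
    using Alpha.prems(2) by auto
  \<comment> \<open>Swapping is an involution, so \<open>as\<close> lists \<open>Y\<close> and is
    renamed back to the requested \<open>ds\<close> by \<open>Alpha\<close>.\<close>
  define as where "as = map (swp c d) ds"
  have as: "distinct as" "set as = Y" "map (swp c d) as = ds"
    using ds by (auto simp: as_def distinct_map inj_on_subset[OF sperm_inj[OF sperm_swp]]
        image_image comp_def swp2)
  obtain A' where A': "psi_trans A (OutA (Nm z) as (Tup ys)) A'" "repr g A' P'"
    using Alpha.IH[OF Alpha.prems(1), of "OutA (Nm z) as (Tup ys)"] as by auto
  then have "psi_trans A (OutA (Nm z) (map (swp c d) as) (map_tm (swp c d) (Tup ys))) (swap_agent c d A')"
    using Alpha.hyps as by (intro psi_trans.Alpha) (auto simp: repr_fn)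
  moreover have "repr g (swap_agent c d A') (swap_pi c d P')"
    using A'(2) by (simp add: swap_agent_eq_subst swap_pi_eq_subst repr_subst)
  ultimately show ?case
    by (auto simp: as ds)
qed

section \<open>Completeness\<close>

text \<open>Well-formedness forces subjects to be names, and objects and patterns to be tuples,
  which are the prefixes available in the pi-calculus.\<close>

lemma ex_repr: "wf_agent ob A \<Longrightarrow> \<exists>P. repr True A P"
proof (induction A rule: agent_induct)
  case (Output M N A)
  then obtain x ys where "M = Nm x" "N = Tup ys"
    by (cases M; cases N) (auto simp: wf_agent_simps)
  with Output show ?case
    by (auto simp: wf_agent_simps intro: repr.Output)
next
  case (Input M xs X A)
  then obtain x ys where "M = Nm x" "X = PTup ys"
    by (cases M; cases X) (auto simp: wf_agent_simps)
  with Input show ?case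
    by (fastforce simp: wf_agent_simps intro: repr.Input)
next
  case (Case Cs)
  have branch: "\<exists>P. repr True (Case [c]) P" if c: "c \<in> set Cs" for c
  proof -
    obtain \<phi> A where A: "c = (\<phi>, A)"
      by (cases c)
    obtain P where "repr True A P"
      using Case.IH[OF c] Case.prems c unfolding A wf_agent_Case by fastforce
    moreover obtain ns where "set ns = fn A"
      using finite_list[of "fn A"] finite_rfn by (auto simp: fn.rep_eq)
    ultimately show ?thesis
      unfolding A by (cases \<phi>) (blast intro: repr.Top repr.Bot repr.Match)+
  qed
  \<comment> \<open>Branches are added one by one with \<open>repr.Cons\<close>; the inclusion keeps
    \<open>branch\<close> applicable to the remaining ones.\<close>
  have "\<exists>P. repr True (Case Ds) P" if "set Ds \<subseteq> set Cs" for Ds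
    using that
  proof (induction Ds)
    case (Cons d Ds)
    then show ?case
      using branch[of d] by (auto intro: repr.Cons)
  qed (auto intro: repr.Nil)
  then show ?case
    by blast
next
  case (Res a A)
  then show ?case
    by (auto simp: wf_agent_simps intro: repr.Res)
next
  case (Par A B)
  then show ?case
    by (auto simp: wf_agent_simps intro: repr.Par)
next
  case (Rep A)
  then show ?case
    by (auto simp: wf_agent_simps intro: repr.Rep)
next
  case (Assert \<Psi>)
  then show ?case
    by (auto intro: repr.Assert)
qed

text \<open>Both agents represent \<open>P\<close>, so a transition of one is first matched by
  \<open>P\<close> and from there by the other, with the same psi action.\<close>

lemma repr_bisimilar:
  assumes "repr True A P" "wf_agent ob A"
  shows "bisimilar ob A (enc P)"
proof -
  \<comment> \<open>Both orientations are included to make the relation symmetric.\<close>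
  define R where "R A B \<longleftrightarrow> wf_agent ob A \<and> wf_agent ob B \<and>
    (\<exists>P. repr True A P \<and> B = enc P \<or> repr True B P \<and> A = enc P)" for A B
  have sim: "\<exists>B'. psi_trans B \<alpha> B' \<and> R A' B'" if AB: "R A B" and t: "psi_trans A \<alpha> A'" for A B \<alpha> A'
  proof -
    obtain P where wf: "wf_agent ob A" "wf_agent ob B"
      and P: "repr True A P \<and> B = enc P \<or> repr True B P \<and> A = enc P"
      using AB by (auto simp: R_def)
    have "well_sorted ob P"
      using P wf repr_well_sorted by blast
    then have "repr False (enc P) P"
      by (rule repr_enc)
    \<comment> \<open>The encoding represents \<open>P\<close> with parameter \<open>False\<close>
      and the other agent with \<open>True\<close>; the sign \<open>g\<close> treats both
      orientations at once.\<close>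
    with P obtain g where gh: "repr g A P" "repr (\<not> g) B P"
      by (metis (full_types))
    obtain \<beta> P' where P': "pi_trans P \<beta> P'" "corr \<beta> \<alpha>" "repr g A' P'"
      using psi_trans_imp_pi_trans[OF t gh(1)] by auto
    obtain B' where B': "psi_trans B \<alpha> B'" "repr (\<not> g) B' P'"
      using pi_trans_imp_psi_trans[OF P'(1) gh(2) P'(2)] by auto
    have "R A' B'"
      using psi_trans_wf[OF t wf(1)] psi_trans_wf[OF B'(1) wf(2)] P'(3) B'(2) repr_False
      by (cases g) (auto simp: R_def)
    then show ?thesis
      using B'(1) by blast
  qed
  moreover have "symp R"
    by (auto simp: symp_def R_def)
  moreover have "wf_agent ob A" "wf_agent ob B" if "R A B" for A B
    using that by (simp_all add: R_def)
  ultimately have "bisimulation ob R"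
    unfolding bisimulation_def by blast
  moreover have "R A (enc P)"
    using assms repr_well_sorted[OF assms] by (auto simp: R_def wf_enc)
  ultimately show ?thesis
    unfolding bisimilar_def by blast
qed

text \<open>Representation and well-formedness are closed under sort-preserving substitution and
  \<open>enc\<close> commutes with it, so every substituted pair is again of the kind treated in
  \<open>repr_bisimilar\<close>.\<close>

lemma repr_bisim_cong:
  assumes "repr True A P" "wf_agent ob A"
  shows "bisim_cong ob A (enc P)"
proof -
  let ?s = "\<lambda>(xs, ls). subst_agent (name_subst xs ls)"
  have "bisimilar ob (fold ?s \<sigma>s A) (fold ?s \<sigma>s (enc P))" if "list_all valid_subst \<sigma>s" for \<sigma>s
    using that assms
  proof (induction \<sigma>s arbitrary: A P)
    case Nil
    then show ?case
      by (simp add: repr_bisimilar)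
  next
    case (Cons \<sigma> \<sigma>s)
    obtain xs ls where \<sigma>: "\<sigma> = (xs, ls)"
      by (cases \<sigma>)
    have "wf_agent ob (subst_agent (name_subst xs ls) A)"
      using Cons.prems by (intro wf_agent_subst sort_of_name_subst) (auto simp: \<sigma> valid_subst_def)
    then show ?case
      using Cons.IH[OF _ repr_subst[OF Cons.prems(2)]] Cons.prems by (simp add: \<sigma> enc_subst)
  qed
  then show ?thesis
    by (simp add: bisim_cong_def)
qed

section \<open>The encoding as a complete representation\<close>

fun enc_ctx :: "'n pcon \<Rightarrow> 'n ctx" where
  "enc_ctx KNil = CCase []"
| "enc_ctx (KIn x ys) = CIn (Nm x) ys (PTup ys) Hole"
| "enc_ctx (KOut x ys) = COut (Nm x) (Tup ys) Hole"
| "enc_ctx (KMatch a b) = CCase [(Eq a b, Hole)]"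
| "enc_ctx (KRes x) = CRes x Hole"
| "enc_ctx KRep = CRep Hole"
| "enc_ctx KPar = CPar Hole Hole"
| "enc_ctx KSum = CCase [(Top, Hole), (Top, Hole)]"

lemma enc_ctx_map: "enc_ctx (map_pcon p f) = map_ctx p (enc_ctx f)"
  by (cases f) auto

lemma holes_enc_ctx: "holes (enc_ctx f) = pcon_arity f"
  by (cases f) auto

lemma enc_build: "length Ps = pcon_arity f \<Longrightarrow> enc (pcon_build f Ps) = fill (enc_ctx f) (map enc Ps)"
  by (cases f) (auto simp: length_Suc_conv numeral_2_eq_2)

text \<open>The type of labels admits infinite sets of bound names, which no list enumerates; those
  arising in transitions are finite.\<close>

lemma ex_corr: "pi_trans P \<beta> P' \<Longrightarrow> \<exists>\<alpha>. corr \<beta> \<alpha>"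
proof (cases \<beta>)
  case (POutA Y z ys)
  assume "pi_trans P \<beta> P'"
  then have "finite (pbn \<beta>)"
    by (induction rule: pi_trans.induct) auto
  then show ?thesis
    using finite_distinct_list[of Y] POutA by auto
qed auto

text \<open>For \<open>g = False\<close> the represented agents are exactly encodings, so
  derivatives agree on the nose and structural congruence is needed only in the form of
  reflexivity.\<close>

lemma representation_enc: "representation ob (sorted_polyadic_pi ob) enc corr"
  unfolding representation_def sorted_polyadic_pi_def calculus.simps
proof (intro conjI)
  show "\<exists>C. (\<forall>a b f. C (map_pcon (swp a b) f) = map_ctx (swp a b) (C f)) \<and>
      (\<forall>f. holes (C f) = pcon_arity f) \<and>
      (\<forall>f Ps. length Ps = pcon_arity f \<longrightarrow> set Ps \<subseteq> {P. well_sorted ob P} \<longrightarrow>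
        pcon_build f Ps \<in> {P. well_sorted ob P} \<longrightarrow> enc (pcon_build f Ps) = fill (C f) (map enc Ps))"
    by (intro exI[of _ enc_ctx]) (simp add: enc_ctx_map holes_enc_ctx enc_build)
next
  show "\<forall>P\<in>{P. well_sorted ob P}. \<forall>\<beta> P'. pi_trans P \<beta> P' \<longrightarrow>
      (\<exists>\<alpha> Q. psi_trans (enc P) \<alpha> Q \<and> scong (enc P') Q \<and> corr \<beta> \<alpha>)"
  proof (intro ballI allI impI)
    fix P P' :: "'a proc" and \<beta>
    assume "P \<in> {P. well_sorted ob P}" and t: "pi_trans P \<beta> P'"
    then have "repr False (enc P) P"
      using repr_enc by auto
    then show "\<exists>\<alpha> Q. psi_trans (enc P) \<alpha> Q \<and> scong (enc P') Q \<and> corr \<beta> \<alpha>"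
      using ex_corr[OF t] pi_trans_imp_psi_trans[OF t] repr_False scong.Refl by metis
  qed
next
  show "\<forall>P\<in>{P. well_sorted ob P}. \<forall>\<alpha> Q. psi_trans (enc P) \<alpha> Q \<longrightarrow>
      (\<exists>\<beta>. \<exists>P'\<in>{P. well_sorted ob P}. pi_trans P \<beta> P' \<and> scong (enc P') Q \<and> corr \<beta> \<alpha>)"
  proof (intro ballI allI impI)
    fix P :: "'a proc" and \<alpha> Q
    assume P: "P \<in> {P. well_sorted ob P}" and t: "psi_trans (enc P) \<alpha> Q"
    then have "repr False (enc P) P"
      using repr_enc by auto
    then obtain \<beta> P' where "pi_trans P \<beta> P'" "corr \<beta> \<alpha>" "repr False Q P'"
      using psi_trans_imp_pi_trans[OF t] by blast
    moreover have "wf_agent ob Q"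
      using psi_trans_wf[OF t] wf_enc P by blast
    ultimately show "\<exists>\<beta>. \<exists>P'\<in>{P. well_sorted ob P}. pi_trans P \<beta> P' \<and> scong (enc P') Q \<and> corr \<beta> \<alpha>"
      using repr_well_sorted repr_False scong.Refl by blast
  qed
qed (auto simp: wf_enc enc_swap corr_swap)

theorem theorem4p12:
  fixes ob :: "'s::countable \<rightharpoonup> 's list"
  shows "is_complete_representation ob (sorted_polyadic_pi ob)"
proof -
  have "\<exists>Q\<in>procs (sorted_polyadic_pi ob). bisim_cong ob P (enc Q)" if "wf_agent ob P" for P
    using ex_repr[OF that] repr_bisim_cong[OF _ that] repr_well_sorted[OF _ that]
    by (auto simp: sorted_polyadic_pi_def)
  then show ?thesis
    using representation_enc unfolding is_complete_representation_def by blast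
qed

end
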